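(* Let $Y$ be a geodesic manifold and $x,y\in Y$. Every simple arc $A\in\Omega_Y(x,y)$ can be straightened to a minimal $C\in\Omega_Y(x,y)$, i.e. there is a minimal $C\in\Omega_Y(x,y)$ with $C\prec A$. A simple arc $A\in\Omega_Y(x,y)$ is minimal if and only if $A$ is a convex simple geodesic.
   Context: **Convexity spaces.** For a Hausdorff space $X$, the power set $\mathfrak{P}(X)$ is given the topology with basis the sets $\widetilde U=\{A\subset X : A\subset U\}$, $U\subset X$ open. A convexity space is a Hausdorff space $X$ with a continuous map $C\colon X\times X\to\mathfrak{P}(X)$ such that, calling $A\subset X$ convex if $C(x,y)\subset A$ for all $x,y\in A$: (C1) every $C(x,y)$ is convex; (C2) $C(x,y)$ is minimal (with respect to inclusion) among the connected subsets of $X$ containing $x$ and $y$ (in particular it is such a set); (C3) $X$ has a basis of convex open sets. A convex subset of a convexity space is a convexity space by restriction. **Local convexity structures.** A local convexity structure (atlas) on a topological space $Y$ is an open covering $\mathcal V$ of $Y$ by convexity spaces $V\in\mathcal V$ (with the induced topology) such that for every $V\in\mathcal V$, every convex open subspace of $V$ belongs to $\mathcal V$ (as a convexity space). A subset $A\subset Y$ is convex if $A\cap V$ is convex in $V$ for all $V\in\mathcal V$; $C(A)$ denotes the smallest convex subset containing $A$ (its convex hull). **Étale maps.** Let $e\colon C\to Y$ be continuous with $C$ connected, $Y$ having local convexity structure $\mathcal V$. $\mathcal V_e$ denotes the set of all open $U\subset C$ mapped by $e$ homeomorphically onto a convex subspace of some $V\in\mathcal V$. $e$ is étale if $e$ is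 a closed map and $\mathcal V_e$ covers $C$. $e$ is generated by a subset $F\subset C$ if there is no closed connected subspace $A\subsetneq C$ with $F\subset A$ such that $e(U\cap A)$ is convex for all $U\in\mathcal V_e$. **Geodesic manifolds.** A geodesic manifold is a Hausdorff space $Y$ with a local convexity structure $\mathcal V$ such that: (G1) for every finite $F\subset Y$, the closure of $C(F)$ is compact; (G2) if an étale map $e\colon C\to Y$ with $C$ compact is generated by $\{x,y\}\subset C$, then every connected $A\subset C$ with $x,y\in A$ equals $C$. A geodesic in $Y$ is an étale map $e\colon C\to Y$ with $C$ compact, generated by some $\{x,y\}\subset C$; its end points are $e(x)$ and $e(y)$. A simple geodesic with end points $x,y$ is a subset $A\subset Y$ with $x,y\in A$ whose inclusion $A\hookrightarrow Y$ is a geodesic (generated by $\{x,y\}$). **Simple arcs.** A linear continuum is a linearly ordered set that is connected in its order topology. A simple arc between $x$ and $y$ is a subspace $A\subset Y$ which is a linear continuum (the subspace topology being the order topology) with end points $x$ and $y$. $\Omega_Y(x,y)$ is the set of all simple arcs between $x$ and $y$. For $A,B\in\Omega_Y(x,y)$, write $A\prec B$ (say: $A$ is a straightening of $B$) if $\overline{C(A)}\subset\overline{C(B)}$. $B\in\Omega_Y(x,y)$ is minimal if $A\prec B$ implies $B\prec A$ for all $A\in\Omega_Y(x,y)$. *)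

theory Defs
  imports "HOL-Analysis.Analysis"
begin

section \<open>Convexity spaces\<close>

definition powerset_topology :: "'a topology \<Rightarrow> 'a set topology" where
  "powerset_topology X = topology_generated_by {Pow U |U. openin X U}"

definition cspace_convex :: "('a \<Rightarrow> 'a \<Rightarrow> 'a set) \<Rightarrow> 'a set \<Rightarrow> bool" where
  "cspace_convex C A \<longleftrightarrow> (\<forall>x\<in>A. \<forall>y\<in>A. C x y \<subseteq> A)"

text \<open>Only the values of \<open>C\<close> at points of \<^term>\<open>topspace X\<close> matter. That these values are
  subsets of \<^term>\<open>topspace X\<close> is part of the continuity requirement.\<close>

definition convexity_space :: "'a topology \<Rightarrow> ('a \<Rightarrow> 'a \<Rightarrow> 'a set) \<Rightarrow> bool" where
  "convexity_space X C \<longleftrightarrow>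
     Hausdorff_space X \<and>
     continuous_map (prod_topology X X) (powerset_topology X) (\<lambda>(x, y). C x y) \<and>
     (\<forall>x\<in>topspace X. \<forall>y\<in>topspace X. cspace_convex C (C x y)) \<and>
     (\<forall>x\<in>topspace X. \<forall>y\<in>topspace X.
        connectedin X (C x y) \<and> x \<in> C x y \<and> y \<in> C x y \<and>
        (\<forall>A. connectedin X A \<and> x \<in> A \<and> y \<in> A \<and> A \<subseteq> C x y \<longrightarrow> A = C x y)) \<and>
     (\<forall>U. openin X U \<longrightarrow> (\<forall>x\<in>U. \<exists>B. openin X B \<and> cspace_convex C B \<and> x \<in> B \<and> B \<subseteq> U))"

section \<open>Local convexity structures\<close>

text \<open>A member \<open>(V, C)\<close> of an atlas stands for the set \<open>V\<close> with the induced topology and the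
  restriction of \<open>C\<close> to \<open>V \<times> V\<close>. The same \<open>V\<close> may carry several convexity structures. Since values
  of \<open>C\<close> outside \<open>V \<times> V\<close> are irrelevant, the restriction of the convexity space \<open>(V, C)\<close> to a convex
  open \<open>U \<subseteq> V\<close> is simply \<open>(U, C)\<close>.\<close>

type_synonym 'a atlas = "('a set \<times> ('a \<Rightarrow> 'a \<Rightarrow> 'a set)) set"

definition local_convexity_structure :: "'a topology \<Rightarrow> 'a atlas \<Rightarrow> bool" where
  "local_convexity_structure Y \<V> \<longleftrightarrow>
     (\<forall>(V, C)\<in>\<V>. openin Y V \<and> convexity_space (subtopology Y V) C) \<and>
     (\<Union>(V, C)\<in>\<V>. V) = topspace Y \<and>
     (\<forall>(V, C)\<in>\<V>. \<forall>U\<subseteq>V. openin Y U \<and> cspace_convex C U \<longrightarrow> (U, C) \<in> \<V>)"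

definition lc_convex :: "'a topology \<Rightarrow> 'a atlas \<Rightarrow> 'a set \<Rightarrow> bool" where
  "lc_convex Y \<V> A \<longleftrightarrow> A \<subseteq> topspace Y \<and> (\<forall>(V, C)\<in>\<V>. cspace_convex C (A \<inter> V))"

definition lc_hull :: "'a topology \<Rightarrow> 'a atlas \<Rightarrow> 'a set \<Rightarrow> 'a set" where
  "lc_hull Y \<V> A = lc_convex Y \<V> hull A"

section \<open>Etale maps\<close>

definition etale_charts :: "'a topology \<Rightarrow> 'a atlas \<Rightarrow> 'c topology \<Rightarrow> ('c \<Rightarrow> 'a) \<Rightarrow> 'c set set" where
  "etale_charts Y \<V> X e =
     {U. openin X U \<and>
         homeomorphic_map (subtopology X U) (subtopology Y (e ` U)) e \<and>
         (\<exists>(V, C)\<in>\<V>. e ` U \<subseteq> V \<and> cspace_convex C (e ` U))}"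

definition etale_map :: "'a topology \<Rightarrow> 'a atlas \<Rightarrow> 'c topology \<Rightarrow> ('c \<Rightarrow> 'a) \<Rightarrow> bool" where
  "etale_map Y \<V> X e \<longleftrightarrow>
     connected_space X \<and> continuous_map X Y e \<and> closed_map X Y e \<and>
     \<Union>(etale_charts Y \<V> X e) = topspace X"

definition etale_generated ::
  "'a topology \<Rightarrow> 'a atlas \<Rightarrow> 'c topology \<Rightarrow> ('c \<Rightarrow> 'a) \<Rightarrow> 'c set \<Rightarrow> bool" where
  "etale_generated Y \<V> X e F \<longleftrightarrow>
     F \<subseteq> topspace X \<and>
     \<not> (\<exists>A. closedin X A \<and> connectedin X A \<and> A \<subset> topspace X \<and> F \<subseteq> A \<and>
            (\<forall>U\<in>etale_charts Y \<V> X e. lc_convex Y \<V> (e ` (U \<inter> A))))"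

section \<open>Geodesics and geodesic manifolds\<close>

text \<open>Compact means compact Hausdorff. The Hausdorff condition on \<open>X\<close> cannot be dropped: an interval
  with one interior point doubled is a non-Hausdorff quasi-compact space whose projection to the
  line is closed, covered by charts, and generated by the two end points, although removing one of
  the doubled points leaves a connected set.\<close>

definition geodesic ::
  "'a topology \<Rightarrow> 'a atlas \<Rightarrow> 'c topology \<Rightarrow> ('c \<Rightarrow> 'a) \<Rightarrow> 'c \<Rightarrow> 'c \<Rightarrow> bool" where
  "geodesic Y \<V> X e x y \<longleftrightarrow>
     etale_map Y \<V> X e \<and> compact_space X \<and> Hausdorff_space X \<and> etale_generated Y \<V> X e {x, y}"

text \<open>The axiom on geodesics quantifies over all compact spaces \<open>X\<close>. A definition can only quantify
  over topologies on a fixed type, but \<open>'a \<times> nat\<close> is large enough: finitely many charts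
  \<open>U\<^sub>0, \<dots>, U\<^sub>n\<close> cover \<open>X\<close>, and \<open>c \<mapsto> (e c, min {i. c \<in> U\<^sub>i})\<close> is injective.
  The lemma \<open>geodesic_manifold_unique_connected\<close> below derives the axiom for spaces over an
  arbitrary type.\<close>

definition geodesic_manifold :: "'a topology \<Rightarrow> 'a atlas \<Rightarrow> bool" where
  "geodesic_manifold Y \<V> \<longleftrightarrow>
     Hausdorff_space Y \<and> local_convexity_structure Y \<V> \<and>
     (\<forall>F. finite F \<and> F \<subseteq> topspace Y \<longrightarrow> compactin Y (Y closure_of lc_hull Y \<V> F)) \<and>
     (\<forall>(X :: ('a \<times> nat) topology) e x y. geodesic Y \<V> X e x y \<longrightarrow>
        (\<forall>A. connectedin X A \<and> x \<in> A \<and> y \<in> A \<longrightarrow> A = topspace X))"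

definition simple_geodesic :: "'a topology \<Rightarrow> 'a atlas \<Rightarrow> 'a \<Rightarrow> 'a \<Rightarrow> 'a set \<Rightarrow> bool" where
  "simple_geodesic Y \<V> x y A \<longleftrightarrow>
     A \<subseteq> topspace Y \<and> x \<in> A \<and> y \<in> A \<and> geodesic Y \<V> (subtopology Y A) (\<lambda>a. a) x y"

section \<open>Simple arcs and straightenings\<close>

definition linorder_topology_on :: "'a set \<Rightarrow> 'a rel \<Rightarrow> 'a topology" where
  "linorder_topology_on A r =
     topology_generated_by (insert A ((underS r ` A) \<union> (aboveS r ` A)))"

definition linear_continuum_on :: "'a set \<Rightarrow> 'a rel \<Rightarrow> bool" where
  "linear_continuum_on A r \<longleftrightarrow>
     linear_order_on A r \<and> connected_space (linorder_topology_on A r)"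

definition simple_arcs :: "'a topology \<Rightarrow> 'a \<Rightarrow> 'a \<Rightarrow> 'a set set" where
  "simple_arcs Y x y =
     {A. A \<subseteq> topspace Y \<and>
         (\<exists>r. linear_continuum_on A r \<and> subtopology Y A = linorder_topology_on A r \<and>
              x \<in> A \<and> y \<in> A \<and> (\<forall>z\<in>A. (x, z) \<in> r \<and> (z, y) \<in> r))}"

definition straightening :: "'a topology \<Rightarrow> 'a atlas \<Rightarrow> 'a set \<Rightarrow> 'a set \<Rightarrow> bool" where
  "straightening Y \<V> A B \<longleftrightarrow> Y closure_of lc_hull Y \<V> A \<subseteq> Y closure_of lc_hull Y \<V> B"

definition minimal_arc :: "'a topology \<Rightarrow> 'a atlas \<Rightarrow> 'a \<Rightarrow> 'a \<Rightarrow> 'a set \<Rightarrow> bool" where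
  "minimal_arc Y \<V> x y B \<longleftrightarrow>
     B \<in> simple_arcs Y x y \<and>
     (\<forall>A\<in>simple_arcs Y x y. straightening Y \<V> A B \<longrightarrow> straightening Y \<V> B A)"

section \<open>Independence of the type used in the definition of geodesic manifolds\<close>

lemma etale_charts_transfer:
  assumes h: "homeomorphic_maps X Z h g"
    and U: "U \<in> etale_charts Y \<V> Z (e \<circ> g)"
  shows "g ` U \<in> etale_charts Y \<V> X e"
proof -
  have gm: "homeomorphic_map Z X g"
    using h homeomorphic_maps_map by blast
  have hm: "homeomorphic_map X Z h"
    using h homeomorphic_maps_map by blast
  have oU: "openin Z U" and
    hU: "homeomorphic_map (subtopology Z U) (subtopology Y ((e \<circ> g) ` U)) (e \<circ> g)" and
    cU: "\<exists>(V, C)\<in>\<V>. (e \<circ> g) ` U \<subseteq> V \<and> cspace_convex C ((e \<circ> g) ` U)"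
    using U by (auto simp: etale_charts_def)
  have Usub: "U \<subseteq> topspace Z" using oU openin_subset by blast
  have ogU: "openin X (g ` U)"
    using homeomorphic_map_openness[OF gm Usub] oU by simp
  have hg: "h ` g ` U = U"
  proof -
    have "h (g z) = z" if "z \<in> U" for z
      using h Usub that by (auto simp: homeomorphic_maps_def)
    then show ?thesis by (simp add: image_image)
  qed
  have "homeomorphic_map (subtopology X (g ` U)) (subtopology Z (h ` g ` U)) h"
    using hm hg Usub openin_subset[OF ogU]
    by (intro homeomorphic_map_subtopologies) (simp_all add: inf.absorb2)
  then have "homeomorphic_map (subtopology X (g ` U)) (subtopology Y ((e \<circ> g) ` U)) ((e \<circ> g) \<circ> h)"
    using homeomorphic_map_compose[OF _ hU] hg by simp
  moreover have "((e \<circ> g) \<circ> h) z = e z" if "z \<in> topspace (subtopology X (g ` U))" for z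
    using h that unfolding homeomorphic_maps_def by simp
  ultimately have "homeomorphic_map (subtopology X (g ` U)) (subtopology Y ((e \<circ> g) ` U)) e"
    by (rule homeomorphic_map_eq)
  then show ?thesis
    using ogU cU by (simp add: etale_charts_def image_comp)
qed

lemma geodesic_transfer:
  assumes h: "homeomorphic_maps X Z h g" and geo: "geodesic Y \<V> X e x y"
  shows "geodesic Y \<V> Z (e \<circ> g) (h x) (h y)"
proof -
  have h': "homeomorphic_maps Z X g h"
    using h homeomorphic_maps_sym by blast
  have gm: "homeomorphic_map Z X g" and hm: "homeomorphic_map X Z h"
    using h homeomorphic_maps_map by blast+
  have hs: "X homeomorphic_space Z"
    using h homeomorphic_space_def by blast
  have gh: "\<And>z. z \<in> topspace X \<Longrightarrow> g (h z) = z" and hg: "\<And>z. z \<in> topspace Z \<Longrightarrow> h (g z) = z"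
    using h by (auto simp: homeomorphic_maps_def)
  have himg: "h ` topspace X = topspace Z" and gimg: "g ` topspace Z = topspace X"
    using hm gm homeomorphic_imp_surjective_map by blast+
  have et: "etale_map Y \<V> X e" and gen: "etale_generated Y \<V> X e {x, y}"
    and cp: "compact_space X" and hd: "Hausdorff_space X"
    using geo by (auto simp: geodesic_def)
  have chX: "U \<subseteq> topspace X" if "U \<in> etale_charts Y \<V> X e" for U
    using that openin_subset by (auto simp: etale_charts_def)
  have chart: "h ` U \<in> etale_charts Y \<V> Z (e \<circ> g)" if U: "U \<in> etale_charts Y \<V> X e" for U
  proof -
    have "homeomorphic_map (subtopology X U) (subtopology Y (e ` U)) ((e \<circ> g) \<circ> h)"
      by (rule homeomorphic_map_eq[of _ _ e]) (use U gh in \<open>auto simp: etale_charts_def\<close>)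
    moreover have "((e \<circ> g) \<circ> h) ` U = e ` U"
      unfolding image_comp[symmetric] image_image
      by (rule image_cong[OF refl]) (use chX[OF U] gh in auto)
    ultimately have "U \<in> etale_charts Y \<V> X ((e \<circ> g) \<circ> h)"
      using U by (simp add: etale_charts_def)
    then show ?thesis
      by (rule etale_charts_transfer[OF h'])
  qed
  have "\<Union>(etale_charts Y \<V> Z (e \<circ> g)) = topspace Z"
  proof
    show "\<Union>(etale_charts Y \<V> Z (e \<circ> g)) \<subseteq> topspace Z"
      by (auto simp: etale_charts_def dest: openin_subset)
    show "topspace Z \<subseteq> \<Union>(etale_charts Y \<V> Z (e \<circ> g))"
    proof
      fix z assume z: "z \<in> topspace Z"
      then have "g z \<in> \<Union>(etale_charts Y \<V> X e)"
        using et gimg by (auto simp: etale_map_def)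
      then obtain U where U: "U \<in> etale_charts Y \<V> X e" "g z \<in> U"
        by (rule UnionE)
      have "z \<in> h ` U"
        using imageI[OF U(2), of h] hg[OF z] by simp
      then show "z \<in> \<Union>(etale_charts Y \<V> Z (e \<circ> g))"
        using chart[OF U(1)] by (rule UnionI[rotated])
    qed
  qed
  moreover have "connected_space Z" "compact_space Z" "Hausdorff_space Z"
    using et cp hd homeomorphic_connected_space[OF hs] homeomorphic_compact_space[OF hs]
      homeomorphic_Hausdorff_space[OF hs] by (simp_all add: etale_map_def)
  moreover have "continuous_map Z Y (e \<circ> g)"
    using et by (intro continuous_map_compose[OF homeomorphic_imp_continuous_map[OF gm]])
      (simp add: etale_map_def)
  moreover have "closed_map Z Y (e \<circ> g)"
    using et by (intro closed_map_compose[OF homeomorphic_imp_closed_map[OF gm]])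
      (simp add: etale_map_def)
  moreover have "etale_generated Y \<V> Z (e \<circ> g) {h x, h y}"
    unfolding etale_generated_def
  proof (intro conjI notI)
    show "{h x, h y} \<subseteq> topspace Z"
      using gen himg by (auto simp: etale_generated_def)
    assume "\<exists>A. closedin Z A \<and> connectedin Z A \<and> A \<subset> topspace Z \<and> {h x, h y} \<subseteq> A \<and>
            (\<forall>U\<in>etale_charts Y \<V> Z (e \<circ> g). lc_convex Y \<V> ((e \<circ> g) ` (U \<inter> A)))"
    then obtain A where A: "closedin Z A" "connectedin Z A" "A \<subset> topspace Z" "{h x, h y} \<subseteq> A"
      and cA: "\<forall>U\<in>etale_charts Y \<V> Z (e \<circ> g). lc_convex Y \<V> ((e \<circ> g) ` (U \<inter> A))"
      by (elim exE conjE)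
    have Asub: "A \<subseteq> topspace Z" using A(3) by (rule psubset_imp_subset)
    have "closedin X (g ` A)"
      using homeomorphic_map_closedness[OF gm Asub] A(1) by simp
    moreover have "connectedin X (g ` A)"
      by (rule connectedin_continuous_map_image[OF homeomorphic_imp_continuous_map[OF gm] A(2)])
    moreover have "g ` A \<subset> topspace X"
    proof -
      obtain z where z: "z \<in> topspace Z" "z \<notin> A"
        using psubset_imp_ex_mem[OF A(3)] by (elim exE DiffE)
      have "g z \<noteq> g a" if "a \<in> A" for a
      proof
        assume "g z = g a"
        then have "h (g z) = h (g a)" by (rule arg_cong)
        then have "z = a" unfolding hg[OF z(1)] hg[OF subsetD[OF Asub that]] .
        then show False using z(2) that by simp
      qed
      then have "g z \<notin> g ` A" by auto
      moreover have "g z \<in> topspace X" "g ` A \<subseteq> topspace X"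
        using z(1) gimg Asub by auto
      ultimately show ?thesis by auto
    qed
    moreover have "{x, y} \<subseteq> g ` A"
    proof -
      have "x = g (h x)" "y = g (h y)" using gh gen by (auto simp: etale_generated_def)
      then show ?thesis using A(4) by (metis empty_subsetI imageI insert_subset)
    qed
    moreover have "lc_convex Y \<V> (e ` (U \<inter> g ` A))" if U: "U \<in> etale_charts Y \<V> X e" for U
    proof -
      have "U \<inter> g ` A = g ` (h ` U \<inter> A)"
      proof
        show "U \<inter> g ` A \<subseteq> g ` (h ` U \<inter> A)"
        proof
          fix c assume "c \<in> U \<inter> g ` A"
          then obtain a where a: "a \<in> A" "c = g a" "g a \<in> U" by auto
          have "a = h (g a)" using hg[of a] Asub a(1) by auto
          then have "a \<in> h ` U \<inter> A" using a by (metis IntI imageI)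
          then show "c \<in> g ` (h ` U \<inter> A)" using a(2) by simp
        qed
        show "g ` (h ` U \<inter> A) \<subseteq> U \<inter> g ` A"
          using chX[OF U] gh by (auto simp: subset_iff)
      qed
      then show ?thesis using bspec[OF cA chart[OF U]] by (simp add: image_comp)
    qed
    ultimately have "\<exists>A. closedin X A \<and> connectedin X A \<and> A \<subset> topspace X \<and> {x, y} \<subseteq> A \<and>
            (\<forall>U\<in>etale_charts Y \<V> X e. lc_convex Y \<V> (e ` (U \<inter> A)))"
      by (intro exI[of _ "g ` A"] conjI ballI)
    then show False
      using gen by (simp add: etale_generated_def)
  qed
  ultimately show ?thesis
    by (simp add: geodesic_def etale_map_def)
qed

lemma etale_compact_encoding:
  fixes X :: "'c topology" and e :: "'c \<Rightarrow> 'a"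
  assumes "etale_map Y \<V> X e" and "compact_space X"
  obtains h :: "'c \<Rightarrow> 'a \<times> nat" where "inj_on h (topspace X)"
proof -
  have "\<forall>U\<in>etale_charts Y \<V> X e. openin X U" "topspace X \<subseteq> \<Union>(etale_charts Y \<V> X e)"
    using assms(1) by (simp add: etale_charts_def) (use assms(1) in \<open>simp add: etale_map_def\<close>)
  then have "\<exists>\<F>. finite \<F> \<and> \<F> \<subseteq> etale_charts Y \<V> X e \<and> topspace X \<subseteq> \<Union>\<F>"
    using assms(2)[unfolded compact_space_alt, rule_format] by simp
  then obtain \<F> where F: "finite \<F>" "\<F> \<subseteq> etale_charts Y \<V> X e" "topspace X \<subseteq> \<Union>\<F>"
    by (elim exE conjE)
  obtain n :: "'c set \<Rightarrow> nat" where n: "inj_on n \<F>"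
    using finite_imp_inj_to_nat_seg[OF F(1)] by (elim exE conjE)
  define k where "k c = (SOME U. U \<in> \<F> \<and> c \<in> U)" for c
  have k: "k c \<in> \<F>" "c \<in> k c" if "c \<in> topspace X" for c
  proof -
    have "\<exists>U. U \<in> \<F> \<and> c \<in> U" using that F(3) by auto
    from someI_ex[OF this] show "k c \<in> \<F>" "c \<in> k c" by (simp_all add: k_def)
  qed
  have inj: "inj_on e U" if "U \<in> \<F>" for U
  proof -
    have "openin X U" "homeomorphic_map (subtopology X U) (subtopology Y (e ` U)) e"
      using that F(2) by (auto simp: etale_charts_def)
    then show ?thesis
      using homeomorphic_imp_injective_map[of "subtopology X U"] openin_subset[of X U]
      by (simp add: inf.absorb2)
  qed
  have "inj_on (\<lambda>c. (e c, n (k c))) (topspace X)"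
  proof (rule inj_onI)
    fix c d assume c: "c \<in> topspace X" and d: "d \<in> topspace X"
      and eq: "(e c, n (k c)) = (e d, n (k d))"
    then have "n (k c) = n (k d)" by simp
    then have "k c = k d" by (rule inj_onD[OF n _ k(1)[OF c] k(1)[OF d]])
    then have "d \<in> k c" using k(2)[OF d] by simp
    moreover have "e c = e d" using eq by simp
    ultimately show "c = d" using inj_onD[OF inj[OF k(1)[OF c]]] k(2)[OF c] by simp
  qed
  then show thesis by (rule that)
qed

lemma geodesic_manifold_unique_connected:
  fixes X :: "'c topology"
  assumes Y: "geodesic_manifold Y \<V>" and geo: "geodesic Y \<V> X e x y"
    and A: "connectedin X A" "x \<in> A" "y \<in> A"
  shows "A = topspace X"
proof -
  obtain h :: "'c \<Rightarrow> 'a \<times> nat" where inj: "inj_on h (topspace X)"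
  proof -
    have "etale_map Y \<V> X e" "compact_space X" using geo by (simp_all add: geodesic_def)
    from etale_compact_encoding[OF this] show thesis using that .
  qed
  define g where "g = inv_into (topspace X) h"
  define Z where "Z = pullback_topology (h ` topspace X) g X"
  have gh: "g (h z) = z" if "z \<in> topspace X" for z
    unfolding g_def by (rule inv_into_f_f[OF inj that])
  have topZ: "topspace Z = h ` topspace X"
    using gh by (auto simp: Z_def topspace_pullback_topology)
  have opZ: "openin Z U \<longleftrightarrow> (\<exists>W. openin X W \<and> U = h ` W)" for U
  proof -
    have "g -` W \<inter> h ` topspace X = h ` W" if "openin X W" for W
      using openin_subset[OF that] gh by (auto simp: subset_iff)
    then show ?thesis
      unfolding Z_def openin_pullback_topology by (intro iff_exI conj_cong refl) simp
  qed
  have "continuous_map X Z h"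
    unfolding continuous_map_def
  proof (intro conjI allI impI)
    show "h \<in> topspace X \<rightarrow> topspace Z" using topZ by blast
    fix U assume "openin Z U"
    then obtain W where W: "openin X W" "U = h ` W" using opZ by blast
    then have "{z \<in> topspace X. h z \<in> U} = W"
      using openin_subset[OF W(1)] inj by (auto dest: inj_onD)
    then show "openin X {z \<in> topspace X. h z \<in> U}" using W by simp
  qed
  moreover have "continuous_map Z X g"
    unfolding Z_def by (simp add: continuous_map_pullback[of X X id, simplified])
  ultimately have hom: "homeomorphic_maps X Z h g"
    unfolding homeomorphic_maps_def using gh topZ by auto
  have geoZ: "geodesic Y \<V> Z (e \<circ> g) (h x) (h y)"
    using geodesic_transfer[OF hom geo] .
  have conZ: "connectedin Z (h ` A)"
    by (rule connectedin_continuous_map_image[OF _ A(1)])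
      (use hom in \<open>simp add: homeomorphic_maps_def\<close>)
  have "\<forall>(X :: ('a \<times> nat) topology) e x y. geodesic Y \<V> X e x y \<longrightarrow>
        (\<forall>A. connectedin X A \<and> x \<in> A \<and> y \<in> A \<longrightarrow> A = topspace X)"
    using Y unfolding geodesic_manifold_def by (elim conjE)
  from this[rule_format, OF geoZ, of "h ` A"] have "h ` A = topspace Z"
    using conZ A by blast
  moreover have "A \<subseteq> topspace X" using A(1) by (rule connectedin_subset_topspace)
  ultimately show ?thesis
    using inj_on_image_eq_iff[OF inj _ order_refl] topZ by simp
qed

end

(*
  Call a connected set irreducible between two of its points if no smaller connected set contains
  both. Its other points are cut points, which order it linearly; a compact irreducible set in a
  Hausdorff space carries the order topology and is thus a simple arc. By (C2) every C(u, v) is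
  irreducible, by (C3) it is locally connected and hence compact, and two consecutive compact arcs
  contain an arc joining their outer end points. So points of a connected convex set K are joined by
  an arc inside the hull of a finite subset of K, and (G1) makes the closure of that hull compact.

  The closure of a convex set is convex: C is upper semicontinuous, and removing an interior point
  z disconnects C(u, v), so segments with end points near u and v must pass near z. Therefore the
  minimal arcs are the arcs A whose closed hull M is minimal among the closed connected convex sets
  containing x and y, and Zorn's lemma provides such M. By minimality the inclusion of M is
  generated by {x, y}, so M is a geodesic, and (G2) applied to the connected subset A gives A = M.
*)

theory Submission
  imports Defs
begin

section \<open>Cut points of irreducible connected sets, and the order and topology they
  induce\<close>

section \<open>Sets irreducible between two points\<close>

text \<open>Axiom (C2) says precisely that \<open>C x y\<close> is of this kind between
  \<open>x\<close> and \<open>y\<close>.\<close>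

definition irreducible_between :: "'a topology \<Rightarrow> 'a set \<Rightarrow> 'a \<Rightarrow> 'a \<Rightarrow> bool" where
  "irreducible_between X A x y \<longleftrightarrow>
     connectedin X A \<and> x \<in> A \<and> y \<in> A \<and>
     (\<forall>B. connectedin X B \<and> x \<in> B \<and> y \<in> B \<and> B \<subseteq> A \<longrightarrow> B = A)"

text \<open>The separation order of continuum theory, phrased with connected subsets instead of cut
  points: reflexivity, transitivity and the minimality of initial segments can then be read off,
  while antisymmetry and totality come from the cuts.\<close>

definition irreducible_order :: "'a topology \<Rightarrow> 'a set \<Rightarrow> 'a \<Rightarrow> 'a rel" where
  "irreducible_order X A x =
     {(a, b). a \<in> A \<and> b \<in> A \<and> (\<forall>D. connectedin X D \<and> D \<subseteq> A \<and> x \<in> D \<and> b \<in> D \<longrightarrow> a \<in> D)}"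

lemma irreducible_between_sym: "irreducible_between X A x y \<Longrightarrow> irreducible_between X A y x"
  by (auto simp: irreducible_between_def)

lemma irreducible_orderD:
  "(a, b) \<in> irreducible_order X A x \<Longrightarrow> connectedin X D \<Longrightarrow> D \<subseteq> A \<Longrightarrow> x \<in> D \<Longrightarrow> b \<in> D \<Longrightarrow> a \<in> D"
  by (auto simp: irreducible_order_def)

lemma separatedin_Int_empty: "separatedin X S T \<Longrightarrow> S \<inter> T = {}"
  using separatedin_imp_disjoint by (auto simp: disjnt_def)

text \<open>If \<open>insert p E\<close> split, the piece without \<open>p\<close> would lie in
  \<open>E\<close>, hence be separated from \<open>F\<close> as well, and would split off from all
  of \<open>G\<close>.\<close>

lemma connectedin_insert_separated:
  assumes G: "connectedin X G" and p: "p \<in> G" and eq: "G - {p} = E \<union> F" and sep: "separatedin X E F"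
  shows "connectedin X (insert p E)"
proof (rule ccontr)
  assume "\<not> connectedin X (insert p E)"
  moreover have "insert p E \<subseteq> topspace X"
    using connectedin_subset_topspace[OF G] p eq by blast
  ultimately obtain C1 C2 where C: "C1 \<union> C2 = insert p E" "C1 \<noteq> {}" "C2 \<noteq> {}" "separatedin X C1 C2"
    unfolding connectedin_eq_not_separated by blast
  have *: False if "P \<union> Q = insert p E" "Q \<noteq> {}" "p \<in> P" "separatedin X P Q" for P Q
  proof -
    have "P \<inter> Q = {}" using that(4) by (rule separatedin_Int_empty)
    then have "p \<notin> Q" using that(3) by blast
    moreover have "Q \<subseteq> insert p E" using that(1) by blast
    ultimately have "Q \<subseteq> E" by blast
    then have "separatedin X Q F" by (rule separatedin_mono[OF sep _ order_refl])
    then have "separatedin X Q (P \<union> F)"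
      using that by (simp add: separatedin_Un separatedin_sym)
    moreover have "Q \<union> (P \<union> F) = G"
    proof -
      have "Q \<union> (P \<union> F) = insert p (E \<union> F)" using that(1) by blast
      then show ?thesis using p by (simp add: eq[symmetric] insert_absorb)
    qed
    moreover have "P \<union> F \<noteq> {}" using that(3) by blast
    ultimately show False using G that(2) unfolding connectedin_eq_not_separated by blast
  qed
  show False
  proof (cases "p \<in> C1")
    case True
    then show False using * C by blast
  next
    case False
    then have "p \<in> C2" using C(1) by blast
    then show False using *[of C2 C1] C by (simp add: Un_commute separatedin_sym)
  qed
qed

text \<open>At an interior point \<open>z\<close>, minimality makes \<open>A - {z}\<close>
  disconnected. Each side together with \<open>z\<close> is connected and a proper subset of
  \<open>A\<close>, so by minimality it cannot contain both \<open>x\<close> and \<open>y\<close>.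
  The form \<open>insert z E\<close> also admits the end points, where one side is taken
  empty.\<close>

lemma irreducible_between_cut:
  assumes A: "irreducible_between X A x y" and z: "z \<in> A"
  obtains E F where "separatedin X E F" "A - {z} = E \<union> F" "x \<in> insert z E" "y \<in> insert z F"
    "connectedin X (insert z E)" "connectedin X (insert z F)"
proof -
  have con: "connectedin X A" and xy: "x \<in> A" "y \<in> A"
    and min: "\<And>B. connectedin X B \<Longrightarrow> x \<in> B \<Longrightarrow> y \<in> B \<Longrightarrow> B \<subseteq> A \<Longrightarrow> B = A"
    using A by (auto simp: irreducible_between_def)
  have sub: "A \<subseteq> topspace X" by (rule connectedin_subset_topspace[OF con])
  consider "z = x" | "z = y" | "z \<noteq> x" "z \<noteq> y" by blast
  then show thesis
  proof cases
    case 1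
    show thesis
      by (rule that[of "{}" "A - {z}"]) (use 1 xy sub con in \<open>auto simp: insert_absorb\<close>)
  next
    case 2
    show thesis
      by (rule that[of "A - {z}" "{}"]) (use 2 xy sub con in \<open>auto simp: insert_absorb\<close>)
  next
    case 3
    have "\<not> connectedin X (A - {z})"
      using min[of "A - {z}"] 3 xy z by blast
    then obtain E F where EF: "E \<union> F = A - {z}" "E \<noteq> {}" "F \<noteq> {}" "separatedin X E F"
      unfolding connectedin_eq_not_separated using sub by blast
    have *: "connectedin X (insert z P) \<and> \<not> (x \<in> P \<and> y \<in> P)"
      if "separatedin X P Q" "A - {z} = P \<union> Q" "Q \<noteq> {}" for P Q
    proof -
      have c: "connectedin X (insert z P)"
        by (rule connectedin_insert_separated[OF con z that(2,1)])
      have "P \<inter> Q = {}" using that by (simp add: separatedin_Int_empty)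
      moreover have "insert z P \<noteq> A" using that(2,3) \<open>P \<inter> Q = {}\<close> by blast
      moreover have "insert z P \<subseteq> A" using that(2) z by blast
      ultimately show ?thesis using min[OF c] c by blast
    qed
    have E: "connectedin X (insert z E)" "\<not> (x \<in> E \<and> y \<in> E)"
      using *[of E F] EF by auto
    have F: "connectedin X (insert z F)" "\<not> (x \<in> F \<and> y \<in> F)"
      using *[of F E] EF by (auto simp: Un_commute separatedin_sym)
    consider "x \<in> E" "y \<in> F" | "x \<in> F" "y \<in> E"
      using EF(1) E(2) F(2) xy 3 by blast
    then show thesis
    proof cases
      case 1
      then show thesis using that[of E F] EF E F by auto
    next
      case 2
      then show thesis using that[of F E] EF E F by (auto simp: Un_commute separatedin_sym)
    qed
  qed
qed

text \<open>Identifies the two sides of any cut with rays of the order, so the sides do not depend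
  on the choice made in \<open>irreducible_between_cut\<close>.\<close>

lemma irreducible_between_cut_order:
  assumes A: "irreducible_between X A x y" and z: "z \<in> A" and w: "w \<in> A"
    and sep: "separatedin X E F" and eq: "A - {z} = E \<union> F"
    and xE: "x \<in> insert z E" and yF: "y \<in> insert z F"
    and cE: "connectedin X (insert z E)" and cF: "connectedin X (insert z F)"
  shows "(w, z) \<in> irreducible_order X A x \<longleftrightarrow> w \<in> insert z E"
    and "(z, w) \<in> irreducible_order X A x \<longleftrightarrow> w \<in> insert z F"
proof -
  have xA: "x \<in> A" using A by (auto simp: irreducible_between_def)
  \<comment> \<open>A connected set through \<open>x\<close> that avoids \<open>a\<close> stays on
    the \<open>x\<close> side of a cut at \<open>a\<close>, so it never reaches
    \<open>b\<close>.\<close>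
  have below: "(a, b) \<in> irreducible_order X A x"
    if "a \<in> A" "separatedin X P Q" "A - {a} = P \<union> Q" "x \<in> insert a P" "b \<in> Q" for a b P Q
  proof -
    have "a \<in> D" if D: "connectedin X D" "D \<subseteq> A" "x \<in> D" "b \<in> D" for D
    proof (rule ccontr)
      assume "a \<notin> D"
      then have "D \<subseteq> P \<union> Q" "x \<in> P" using D that \<open>x \<in> insert a P\<close> \<open>A - {a} = P \<union> Q\<close> by auto
      then show False
        using connectedin_subset_separated_union[OF D(1) \<open>separatedin X P Q\<close>] D(3,4) \<open>b \<in> Q\<close>
          separatedin_Int_empty[OF \<open>separatedin X P Q\<close>] by blast
    qed
    then show ?thesis
      using that by (auto simp: irreducible_order_def)
  qed
  \<comment> \<open>Compare with a second cut, at \<open>a\<close>. The connected set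
    \<open>insert z F\<close> avoids \<open>a\<close> and contains \<open>y\<close>, so it lies on
    the far side \<open>Q\<close>, which puts \<open>z\<close> beyond \<open>a\<close>; the near
    side \<open>insert a P\<close> then reaches \<open>a\<close> without meeting
    \<open>z\<close>.\<close>
  have Ez: "(a, z) \<in> irreducible_order X A x \<and> (z, a) \<notin> irreducible_order X A x" if a: "a \<in> E" for a
  proof -
    have aA: "a \<in> A" using a eq by blast
    obtain P Q where PQ: "separatedin X P Q" "A - {a} = P \<union> Q" "x \<in> insert a P" "y \<in> insert a Q"
      "connectedin X (insert a P)" "connectedin X (insert a Q)"
      by (rule irreducible_between_cut[OF A aA])
    have nz: "a \<noteq> z" "a \<notin> insert z F" using a eq separatedin_Int_empty[OF sep] by auto
    have "insert z F \<subseteq> P \<union> Q" using nz PQ(2) eq z by blast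
    moreover have "y \<in> Q" using yF nz PQ(4) by auto
    ultimately have sub: "insert z F \<subseteq> Q"
      using connectedin_subset_separated_union[OF cF PQ(1)] yF separatedin_Int_empty[OF PQ(1)] by blast
    have 1: "(a, z) \<in> irreducible_order X A x"
      using below[OF aA PQ(1,2,3)] sub by blast
    have "z \<notin> insert a P" using sub nz separatedin_Int_empty[OF PQ(1)] by blast
    moreover have "insert a P \<subseteq> A" using PQ(2) aA by blast
    ultimately have "(z, a) \<notin> irreducible_order X A x"
      using irreducible_orderD[OF _ PQ(5) _ PQ(3)] by blast
    then show ?thesis using 1 by simp
  qed
  have Fz: "(z, b) \<in> irreducible_order X A x \<and> (b, z) \<notin> irreducible_order X A x" if b: "b \<in> F" for b
  proof
    show "(z, b) \<in> irreducible_order X A x" by (rule below[OF z sep eq xE b])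
    have "insert z E \<subseteq> A" using eq z by blast
    moreover have "b \<notin> insert z E" using b eq separatedin_Int_empty[OF sep] by blast
    ultimately show "(b, z) \<notin> irreducible_order X A x"
      using irreducible_orderD[OF _ cE _ xE] by blast
  qed
  have "(z, z) \<in> irreducible_order X A x" using z by (auto simp: irreducible_order_def)
  then show "(w, z) \<in> irreducible_order X A x \<longleftrightarrow> w \<in> insert z E"
    and "(z, w) \<in> irreducible_order X A x \<longleftrightarrow> w \<in> insert z F"
    using Ez Fz w eq by blast+
qed

lemma irreducible_order_facts:
  assumes A: "irreducible_between X A x y" and z: "z \<in> A"
  defines "r \<equiv> irreducible_order X A x"
  shows "separatedin X (underS r z) (aboveS r z)"
    and "A - {z} = underS r z \<union> aboveS r z"
    and "connectedin X (insert z (underS r z))"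
    and "(x, z) \<in> r" and "(z, y) \<in> r"
    and "(z, w) \<in> r \<Longrightarrow> (w, z) \<in> r \<Longrightarrow> w = z"
proof -
  obtain E F where EF: "separatedin X E F" "A - {z} = E \<union> F" "x \<in> insert z E" "y \<in> insert z F"
    "connectedin X (insert z E)" "connectedin X (insert z F)"
    by (rule irreducible_between_cut[OF A z])
  have xy: "x \<in> A" "y \<in> A" using A by (auto simp: irreducible_between_def)
  note ord = irreducible_between_cut_order[OF A z _ EF, folded r_def]
  have rA: "r \<subseteq> A \<times> A" by (auto simp: r_def irreducible_order_def)
  have E: "underS r z = E" using ord(1) rA EF(2) unfolding underS_def by blast
  have F: "aboveS r z = F" using ord(2) rA EF(2) unfolding aboveS_def by blast
  show "separatedin X (underS r z) (aboveS r z)" "A - {z} = underS r z \<union> aboveS r z"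
    "connectedin X (insert z (underS r z))" "(x, z) \<in> r" "(z, y) \<in> r"
    using E F EF ord xy by auto
  have "E \<inter> F = {}" using EF(1) by (rule separatedin_Int_empty)
  then show "w = z" if "(z, w) \<in> r" "(w, z) \<in> r"
    using that E F by (auto simp: underS_def aboveS_def)
qed

lemma linear_order_irreducible_order:
  assumes A: "irreducible_between X A x y"
  shows "linear_order_on A (irreducible_order X A x)"
proof -
  let ?r = "irreducible_order X A x"
  have rA: "?r \<subseteq> A \<times> A" by (auto simp: irreducible_order_def)
  have "refl_on A ?r" by (auto simp: refl_on_def irreducible_order_def)
  moreover have "trans ?r" unfolding trans_def irreducible_order_def by blast
  moreover have "antisym ?r"
    using irreducible_order_facts(6)[OF A] rA unfolding antisym_def by blast
  moreover have "total_on A ?r"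
    using irreducible_order_facts(2)[OF A] unfolding total_on_def underS_def aboveS_def by blast
  ultimately show ?thesis using rA
    by (simp add: linear_order_on_def partial_order_on_def preorder_on_def)
qed

text \<open>Induction along a connected set. The condition on \<open>W\<close> is symmetric in
  \<open>s\<close> and \<open>t\<close>, so \<open>P\<close> is constant on each \<open>W\<close>,
  and both the set where \<open>P\<close> holds and its complement in \<open>K\<close> are
  open.\<close>

lemma connectedin_local_propagation:
  assumes K: "connectedin X K" and x: "x \<in> K" "P x" and y: "y \<in> K"
    and loc: "\<And>p. p \<in> K \<Longrightarrow>
      \<exists>W. openin (subtopology X K) W \<and> p \<in> W \<and> (\<forall>s\<in>W. \<forall>t\<in>W. P s \<longrightarrow> P t)"
  shows "P y"
proof -
  have top: "topspace (subtopology X K) = K"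
    using connectedin_subset_topspace[OF K] by auto
  \<comment> \<open>Stated for a predicate \<open>Q\<close> so that it serves both \<open>P\<close>
    and its negation.\<close>
  have op: "openin (subtopology X K) {p \<in> K. Q p}"
    if Q: "\<And>p W. \<forall>s\<in>W. \<forall>t\<in>W. P s \<longrightarrow> P t \<Longrightarrow> p \<in> W \<Longrightarrow> Q p \<Longrightarrow> \<forall>t\<in>W. Q t" for Q
  proof (subst openin_subopen, rule ballI)
    fix p assume p: "p \<in> {p \<in> K. Q p}"
    then obtain W where W: "openin (subtopology X K) W" "p \<in> W" "\<forall>s\<in>W. \<forall>t\<in>W. P s \<longrightarrow> P t"
      using loc[of p] by auto
    then have "W \<subseteq> {p \<in> K. Q p}"
      using Q[OF W(3,2)] p openin_imp_subset[OF W(1)] by auto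
    then show "\<exists>T. openin (subtopology X K) T \<and> p \<in> T \<and> T \<subseteq> {p \<in> K. Q p}"
      using W(1,2) by (intro exI[of _ W]) simp
  qed
  have "openin (subtopology X K) {p \<in> K. P p}"
    by (rule op) blast
  moreover have "openin (subtopology X K) {p \<in> K. \<not> P p}"
    by (rule op) blast
  moreover have "K - {p \<in> K. P p} = {p \<in> K. \<not> P p}" by auto
  ultimately have "closedin (subtopology X K) {p \<in> K. P p}"
    unfolding closedin_def top by simp
  moreover have "connected_space (subtopology X K)"
    using K by (simp add: connectedin_def)
  ultimately have "{p \<in> K. P p} = {} \<or> {p \<in> K. P p} = K"
    using \<open>openin (subtopology X K) {p \<in> K. P p}\<close> unfolding connected_space_clopen_in top by blast
  then show ?thesis using x y by auto
qed

text \<open>The covering argument for a real interval: propagate along \<open>A\<close> the property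
  that the initial segment up to \<open>t\<close> has a finite subcover.\<close>

lemma irreducible_between_compactin:
  assumes A: "irreducible_between X A x y"
    and loc: "\<And>a U. a \<in> A \<Longrightarrow> openin X U \<Longrightarrow> a \<in> U \<Longrightarrow>
      \<exists>W. openin (subtopology X A) W \<and> a \<in> W \<and> W \<subseteq> U \<and> connectedin X W"
  shows "compactin X A"
  unfolding compactin_def
proof (intro conjI allI impI)
  have con: "connectedin X A" and x: "x \<in> A" and y: "y \<in> A"
    using A by (auto simp: irreducible_between_def)
  show "A \<subseteq> topspace X" by (rule connectedin_subset_topspace[OF con])
  fix \<U> assume U: "(\<forall>U\<in>\<U>. openin X U) \<and> A \<subseteq> \<Union>\<U>"
  let ?r = "irreducible_order X A x"
  let ?P = "\<lambda>t. \<exists>\<F>. finite \<F> \<and> \<F> \<subseteq> \<U> \<and> insert t (underS ?r t) \<subseteq> \<Union>\<F>"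
  have "?P y"
  proof (rule connectedin_local_propagation[OF con x _ y])
    have "a = x" if "(a, x) \<in> ?r" for a
      using irreducible_order_facts(6)[OF A x _ that] irreducible_order_facts(4)[OF A, of a] that
      by (auto simp: irreducible_order_def)
    then have "underS ?r x = {}" by (auto simp: underS_def)
    moreover obtain U where "U \<in> \<U>" "x \<in> U" using U x by blast
    ultimately show "?P x" by (intro exI[of _ "{U}"]) simp
  next
    fix p assume p: "p \<in> A"
    then obtain U where U': "U \<in> \<U>" "p \<in> U" "openin X U" using U by blast
    obtain W where W: "openin (subtopology X A) W" "p \<in> W" "W \<subseteq> U" "connectedin X W"
      using loc[OF p U'(3,2)] by (elim exE conjE)
    have WA: "W \<subseteq> A" using W(1) by (rule openin_imp_subset)
    have "?P t" if s: "s \<in> W" and t: "t \<in> W" and Ps: "?P s" for s t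
    proof -
      obtain \<F> where F: "finite \<F>" "\<F> \<subseteq> \<U>" "insert s (underS ?r s) \<subseteq> \<Union>\<F>"
        using Ps by (elim exE conjE)
      let ?L = "insert s (underS ?r s)"
      have sA: "s \<in> A" using s WA by blast
      \<comment> \<open>A connected set from \<open>x\<close> to \<open>t\<close> contains every
        predecessor of \<open>t\<close>, so adding the single member \<open>U\<close> to the cover
        suffices, whichever of \<open>s\<close> and \<open>t\<close> comes first.\<close>
      have "connectedin X (?L \<union> W)"
        by (rule connectedin_Un[OF irreducible_order_facts(3)[OF A sA] W(4)]) (use s in blast)
      moreover have "?L \<union> W \<subseteq> A" using sA WA by (auto simp: underS_def irreducible_order_def)
      moreover have "x \<in> ?L \<union> W" using irreducible_order_facts(4)[OF A sA] by (auto simp: underS_def)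
      moreover have "t \<in> ?L \<union> W" using t by simp
      ultimately have "a \<in> ?L \<union> W" if "(a, t) \<in> ?r" for a
        by (rule irreducible_orderD[OF that])
      then have "insert t (underS ?r t) \<subseteq> ?L \<union> W"
        using t by (auto simp: underS_def)
      also have "\<dots> \<subseteq> \<Union>(insert U \<F>)"
        using F(3) W(3) by auto
      finally have "insert t (underS ?r t) \<subseteq> \<Union>(insert U \<F>)" .
      then show ?thesis using F U'(1) by (intro exI[of _ "insert U \<F>"] conjI) auto
    qed
    then show "\<exists>W. openin (subtopology X A) W \<and> p \<in> W \<and> (\<forall>s\<in>W. \<forall>t\<in>W. ?P s \<longrightarrow> ?P t)"
      using W(1,2) by (intro exI[of _ W] conjI ballI impI)
  qed
  then obtain \<F> where "finite \<F>" "\<F> \<subseteq> \<U>" "insert y (underS ?r y) \<subseteq> \<Union>\<F>" by (elim exE conjE)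
  moreover have "A \<subseteq> insert y (underS ?r y)"
    using irreducible_order_facts(5)[OF A] by (auto simp: underS_def)
  ultimately show "\<exists>\<F>. finite \<F> \<and> \<F> \<subseteq> \<U> \<and> A \<subseteq> \<Union>\<F>"
    by (intro exI[of _ \<F>] conjI) auto
qed

text \<open>One side of a cut misses the closure of the other, and \<open>{z}\<close> is closed, so
  each ray is the part of \<open>A\<close> outside a closed set.\<close>

lemma irreducible_order_open:
  assumes X: "t1_space X" and A: "irreducible_between X A x y" and z: "z \<in> A"
  shows "openin (subtopology X A) (underS (irreducible_order X A x) z)"
    and "openin (subtopology X A) (aboveS (irreducible_order X A x) z)"
proof -
  have sub: "A \<subseteq> topspace X" using A connectedin_subset_topspace by (auto simp: irreducible_between_def)
  have *: "openin (subtopology X A) P" if "separatedin X P Q" "A - {z} = P \<union> Q" for P Q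
  proof -
    have cl: "X closure_of insert z Q = insert z (X closure_of Q)"
      using X z sub closure_of_Un[of X "{z}" Q]
      by (simp add: closure_of_closedin t1_space_closedin_singleton subset_iff)
    have "P \<inter> X closure_of Q = {}" "Q \<subseteq> X closure_of Q"
      using that(1) by (auto simp: separatedin_def closure_of_subset)
    then have "P = A - X closure_of insert z Q"
      using that(2) z unfolding cl by blast
    then show ?thesis
      using openin_subtopology_diff_closed[OF sub closedin_closure_of] by metis
  qed
  note f = irreducible_order_facts(1,2)[OF A z]
  show "openin (subtopology X A) (underS (irreducible_order X A x) z)"
    using *[OF f] .
  show "openin (subtopology X A) (aboveS (irreducible_order X A x) z)"
    using *[of "aboveS (irreducible_order X A x) z" "underS (irreducible_order X A x) z"] f
    by (simp add: separatedin_sym Un_commute)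
qed

lemma linorder_topology_on_openin:
  "z \<in> A \<Longrightarrow> openin (linorder_topology_on A r) (underS r z)"
  "z \<in> A \<Longrightarrow> openin (linorder_topology_on A r) (aboveS r z)"
  by (auto simp: linorder_topology_on_def intro!: topology_generated_by_Basis)

text \<open>Two points with a third between them are separated by the rays at that point; if there
  is none, the rays \<open>underS r b\<close> and \<open>aboveS r a\<close> are already
  disjoint.\<close>

lemma Hausdorff_space_linorder_topology_on:
  assumes r: "linear_order_on A r"
  shows "Hausdorff_space (linorder_topology_on A r)"
proof -
  let ?T = "linorder_topology_on A r"
  have rA: "r \<subseteq> A \<times> A"
    using r by (simp add: order_on_defs)
  have anti: "\<And>a b. (a, b) \<in> r \<Longrightarrow> (b, a) \<in> r \<Longrightarrow> a = b"
    using r by (meson antisymD linear_order_on_def partial_order_onD(3))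
  have tot: "\<And>a b. a \<in> A \<Longrightarrow> b \<in> A \<Longrightarrow> a \<noteq> b \<Longrightarrow> (a, b) \<in> r \<or> (b, a) \<in> r"
    using r by (simp add: linear_order_on_def total_on_def)
  have top: "topspace ?T = A"
    using rA by (auto simp: linorder_topology_on_def underS_def aboveS_def)
  have *: "\<exists>U V. openin ?T U \<and> openin ?T V \<and> a \<in> U \<and> b \<in> V \<and> disjnt U V"
    if "(a, b) \<in> r" "a \<noteq> b" for a b
  proof (cases "\<exists>c. (a, c) \<in> r \<and> (c, b) \<in> r \<and> c \<noteq> a \<and> c \<noteq> b")
    case True
    then obtain c where c: "(a, c) \<in> r" "(c, b) \<in> r" "c \<noteq> a" "c \<noteq> b" by blast
    have "disjnt (underS r c) (aboveS r c)"
      using anti by (auto simp: disjnt_def underS_def aboveS_def)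
    moreover have "a \<in> underS r c" "b \<in> aboveS r c" using c by (auto simp: underS_def aboveS_def)
    moreover have "c \<in> A" using c rA by blast
    ultimately show ?thesis using linorder_topology_on_openin[of c A r] by blast
  next
    case False
    then have "disjnt (underS r b) (aboveS r a)"
      by (auto simp: disjnt_def underS_def aboveS_def)
    moreover have "a \<in> underS r b" "b \<in> aboveS r a"
      using that by (auto simp: underS_def aboveS_def)
    moreover have "a \<in> A" "b \<in> A" using that rA by auto
    ultimately show ?thesis using linorder_topology_on_openin[of _ A r] by blast
  qed
  have "\<exists>U V. openin ?T U \<and> openin ?T V \<and> a \<in> U \<and> b \<in> V \<and> disjnt U V"
    if "a \<in> A" "b \<in> A" "a \<noteq> b" for a b
    using tot[OF that] *[of a b] *[of b a] that(3) by (metis disjnt_sym)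
  then show ?thesis
    unfolding Hausdorff_space_def top by blast
qed

text \<open>The rays are open in the subspace \<open>A\<close>, so its topology refines the order
  topology; a compact topology refining a Hausdorff one equals it. The order topology is then
  connected because \<open>A\<close> is.\<close>

lemma irreducible_between_simple_arc:
  assumes Y: "Hausdorff_space Y" and A: "irreducible_between Y A x y" and cpt: "compactin Y A"
  shows "A \<in> simple_arcs Y x y"
proof -
  let ?r = "irreducible_order Y A x"
  let ?T = "linorder_topology_on A ?r"
  have con: "connectedin Y A" and xy: "x \<in> A" "y \<in> A"
    using A by (auto simp: irreducible_between_def)
  have sub: "A \<subseteq> topspace Y" by (rule connectedin_subset_topspace[OF con])
  have lin: "linear_order_on A ?r" by (rule linear_order_irreducible_order[OF A])
  have top: "topspace ?T = A" "\<Union>(insert A (underS ?r ` A \<union> aboveS ?r ` A)) = A"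
    by (auto simp: linorder_topology_on_def underS_def aboveS_def irreducible_order_def)
  note op = irreducible_order_open[OF Hausdorff_imp_t1_space[OF Y] A]
  have cont: "continuous_map (subtopology Y A) ?T (\<lambda>a. a)"
    unfolding linorder_topology_on_def
  proof (rule continuous_on_generated_topo)
    fix U assume "U \<in> insert A (underS ?r ` A \<union> aboveS ?r ` A)"
    then have "openin (subtopology Y A) U"
      using op openin_topspace[of "subtopology Y A"] sub by (auto simp: inf.absorb2)
    then show "openin (subtopology Y A) ((\<lambda>a. a) -` U \<inter> topspace (subtopology Y A))"
      using openin_subset[of "subtopology Y A" U] by (simp add: inf.absorb1)
  next
    show "(\<lambda>a. a) ` topspace (subtopology Y A) \<subseteq> \<Union>(insert A (underS ?r ` A \<union> aboveS ?r ` A))"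
      unfolding top by auto
  qed
  have "subtopology Y A = ?T"
  proof (rule compact_Hausdorff_space_optimal)
    show "topspace (subtopology Y A) = topspace ?T" using sub top by auto
    show "openin (subtopology Y A) U" if "openin ?T U" for U
    proof -
      have "{a \<in> topspace (subtopology Y A). a \<in> U} = U"
        using openin_subset[OF that] top(1) sub by auto
      then show ?thesis using openin_continuous_map_preimage[OF cont that] by simp
    qed
    show "Hausdorff_space ?T" by (rule Hausdorff_space_linorder_topology_on[OF lin])
    show "compact_space (subtopology Y A)" using cpt by (simp add: compactin_subspace)
  qed
  then show ?thesis
    using lin con xy sub irreducible_order_facts(4,5)[OF A]
    by (auto simp: simple_arcs_def linear_continuum_on_def connectedin_def intro!: exI[of _ ?r])
qed

section \<open>Nested intersections of continua, and concatenation of arcs at a first common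
  point\<close>

section \<open>Joining compact irreducible sets\<close>

lemma finite_chain_Inter_mem:
  assumes "finite \<F>" "\<F> \<noteq> {}" "\<And>S T. S \<in> \<F> \<Longrightarrow> T \<in> \<F> \<Longrightarrow> S \<subseteq> T \<or> T \<subseteq> S"
  shows "\<Inter>\<F> \<in> \<F>"
  using assms
proof (induction rule: finite_ne_induct)
  case (insert S \<F>)
  then have "\<Inter>\<F> \<in> \<F>" by simp
  then have "S \<subseteq> \<Inter>\<F> \<or> \<Inter>\<F> \<subseteq> S" using insert.prems by simp
  then show ?case using \<open>\<Inter>\<F> \<in> \<F>\<close> by (auto simp: inf.absorb1 inf.absorb2)
qed simp

text \<open>A finite part of a chain has a least member, which is nonempty, so the finite
  intersection property holds inside the compact member \<open>K\<close>.\<close>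

lemma compactin_chain_Inter_nonempty:
  assumes K: "compactin X K" "K \<in> \<C>"
    and closed: "\<And>S. S \<in> \<C> \<Longrightarrow> closedin X S" and ne: "\<And>S. S \<in> \<C> \<Longrightarrow> S \<noteq> {}"
    and chain: "\<And>S T. S \<in> \<C> \<Longrightarrow> T \<in> \<C> \<Longrightarrow> S \<subseteq> T \<or> T \<subseteq> S"
  shows "\<Inter>\<C> \<noteq> {}"
proof -
  have "K \<inter> \<Inter>\<F> \<noteq> {}" if "finite \<F>" "\<F> \<subseteq> \<C>" for \<F>
  proof -
    have "\<Inter>(insert K \<F>) \<in> insert K \<F>"
      by (rule finite_chain_Inter_mem) (use that K chain in auto)
    then have "\<Inter>(insert K \<F>) \<in> \<C>" using that K by auto
    then show ?thesis using ne[of "\<Inter>(insert K \<F>)"] by simp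
  qed
  then have "K \<inter> \<Inter>\<C> \<noteq> {}"
    using K(1) closed unfolding compactin_fip by simp
  then show ?thesis by auto
qed

text \<open>A separation of the intersection extends to disjoint open \<open>U\<close> and
  \<open>V\<close>. No member \<open>S\<close>, being connected, fits into their union, so the sets
  \<open>S - (U \<union> V)\<close> form a chain of nonempty closed sets; a common point of these
  would lie in the intersection but outside \<open>U \<union> V\<close>.\<close>

lemma connectedin_chain_Inter:
  assumes X: "Hausdorff_space X" and K: "compactin X K" "K \<in> \<C>"
    and closed: "\<And>S. S \<in> \<C> \<Longrightarrow> closedin X S" and con: "\<And>S. S \<in> \<C> \<Longrightarrow> connectedin X S"
    and chain: "\<And>S T. S \<in> \<C> \<Longrightarrow> T \<in> \<C> \<Longrightarrow> S \<subseteq> T \<or> T \<subseteq> S"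
  shows "connectedin X (\<Inter>\<C>)"
proof (rule ccontr)
  assume ncon: "\<not> connectedin X (\<Inter>\<C>)"
  define I where "I = \<Inter>\<C>"
  have IS: "I \<subseteq> S" if "S \<in> \<C>" for S using that by (auto simp: I_def)
  have cl: "closedin X I" unfolding I_def using closed K(2) by (intro closedin_Inter) auto
  have "\<exists>P Q. closedin X P \<and> closedin X Q \<and> I \<subseteq> P \<union> Q \<and> P \<inter> Q \<inter> I = {} \<and> P \<inter> I \<noteq> {} \<and> Q \<inter> I \<noteq> {}"
    using ncon closedin_subset[OF cl] unfolding connectedin_closedin I_def[symmetric]
    by (simp add: conj_ac)
  then obtain P Q where PQ: "closedin X P" "closedin X Q" "I \<subseteq> P \<union> Q" "P \<inter> Q \<inter> I = {}"
    "P \<inter> I \<noteq> {}" "Q \<inter> I \<noteq> {}" by (elim exE conjE)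
  have cpt: "compactin X I" unfolding I_def by (rule closed_compactin_Inter[OF K closed])
  have "disjnt (P \<inter> I) (Q \<inter> I)" using PQ(4) by (auto simp: disjnt_def)
  then obtain U V where UV: "openin X U" "openin X V" "P \<inter> I \<subseteq> U" "Q \<inter> I \<subseteq> V" "disjnt U V"
    by (rule Hausdorff_space_compact_separation[OF X closed_Int_compactin[OF PQ(1) cpt]
          closed_Int_compactin[OF PQ(2) cpt]])
  let ?\<D> = "(\<lambda>S. S - (U \<union> V)) ` \<C>"
  have "\<Inter>?\<D> \<noteq> {}"
  proof (rule compactin_chain_Inter_nonempty)
    show "K - (U \<union> V) \<in> ?\<D>" using K(2) by simp
    have cl': "closedin X (S - (U \<union> V))" if "S \<in> \<C>" for S
      by (intro closedin_diff closed[OF that] openin_Un UV)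
    show "compactin X (K - (U \<union> V))"
      by (rule closed_compactin[OF K(1) Diff_subset cl'[OF K(2)]])
    show "closedin X D" if "D \<in> ?\<D>" for D using that cl' by (elim imageE) simp
    show "D \<noteq> {}" if D: "D \<in> ?\<D>" for D
    proof
      assume "D = {}"
      moreover obtain S where S: "S \<in> \<C>" "D = S - (U \<union> V)" using D by (elim imageE)
      ultimately have SUV: "S \<subseteq> U \<union> V" by simp
      have "U \<inter> S \<noteq> {}" using PQ(5) UV(3) IS[OF S(1)] by blast
      moreover have "V \<inter> S \<noteq> {}" using PQ(6) UV(4) IS[OF S(1)] by blast
      moreover have "U \<inter> V \<inter> S = {}" using UV(5) by (auto simp: disjnt_def)
      ultimately have "\<not> connectedin X S"
        unfolding connectedin using SUV UV(1,2) by (simp only: not_not de_Morgan_conj) blast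
      then show False using con[OF S(1)] by simp
    qed
    show "D \<subseteq> E \<or> E \<subseteq> D" if DE: "D \<in> ?\<D>" "E \<in> ?\<D>" for D E
    proof -
      obtain S where S: "S \<in> \<C>" "D = S - (U \<union> V)" using DE(1) by (elim imageE)
      obtain T where T: "T \<in> \<C>" "E = T - (U \<union> V)" using DE(2) by (elim imageE)
      show ?thesis using chain[OF S(1) T(1)] unfolding S(2) T(2) by blast
    qed
  qed
  then obtain p where p: "p \<in> \<Inter>?\<D>" unfolding ex_in_conv[symmetric] by (elim exE)
  have "p \<in> S - (U \<union> V)" if "S \<in> \<C>" for S
    using InterD[OF p, of "S - (U \<union> V)"] that by simp
  then have "p \<in> I" "p \<notin> U \<union> V" using K(2) by (auto simp: I_def)
  then show False using PQ(3) UV(3,4) by blast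
qed

text \<open>Connected subsets of \<open>A\<close> through \<open>x\<close> and \<open>p\<close>
  contain \<open>L\<close> by the definition of the order, which gives minimality; the complement of
  \<open>L\<close> in \<open>A\<close> is the open ray above \<open>p\<close>.\<close>

lemma irreducible_between_initial_segment:
  assumes X: "t1_space X" and A: "irreducible_between X A x y" and p: "p \<in> A"
  defines "L \<equiv> {a. (a, p) \<in> irreducible_order X A x}"
  shows "irreducible_between X L x p" and "L \<subseteq> A" and "closedin (subtopology X A) L"
    and "\<And>a b. (a, b) \<in> irreducible_order X A x \<Longrightarrow> b \<in> L \<Longrightarrow> a \<in> L"
proof -
  let ?r = "irreducible_order X A x"
  have sub: "A \<subseteq> topspace X" using A connectedin_subset_topspace by (auto simp: irreducible_between_def)
  have L: "L = insert p (underS ?r p)"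
    using p by (auto simp: L_def underS_def irreducible_order_def)
  show LA: "L \<subseteq> A" by (auto simp: L_def irreducible_order_def)
  show "irreducible_between X L x p"
    unfolding irreducible_between_def
  proof (intro conjI allI impI)
    show "connectedin X L" unfolding L by (rule irreducible_order_facts(3)[OF A p])
    show "x \<in> L" using irreducible_order_facts(4)[OF A p] by (simp add: L_def)
    show "p \<in> L" by (simp add: L)
    fix D assume D: "connectedin X D \<and> x \<in> D \<and> p \<in> D \<and> D \<subseteq> L"
    then have "L \<subseteq> D" using LA irreducible_orderD[of _ p X A x D] by (auto simp: L_def)
    then show "D = L" using D by auto
  qed
  have "A - L = aboveS ?r p"
    using irreducible_order_facts(2)[OF A p] irreducible_order_facts(6)[OF A p] p
    by (auto simp: L underS_def aboveS_def)
  then show "closedin (subtopology X A) L"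
    using irreducible_order_open(2)[OF X A p] LA sub by (simp add: closedin_def inf.absorb2)
  show "a \<in> L" if "(a, b) \<in> ?r" "b \<in> L" for a b
    using that linear_order_irreducible_order[OF A]
    by (auto simp: L_def order_on_defs dest: transD)
qed

text \<open>A connected \<open>G\<close> from \<open>x\<close> to \<open>z\<close> must pass through
  \<open>p\<close>, because \<open>L - R\<close> and \<open>R - L\<close> are separated. It is
  thereby cut at \<open>p\<close> into connected halves, to which the minimality of \<open>L\<close>
  and of \<open>R\<close> applies.\<close>

lemma irreducible_between_append:
  assumes L: "irreducible_between X L x p" "closedin X L" and R: "irreducible_between X R p z" "closedin X R"
    and LR: "L \<inter> R = {p}"
  shows "irreducible_between X (L \<union> R) x z"
  unfolding irreducible_between_def
proof (intro conjI allI impI)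
  show "connectedin X (L \<union> R)"
    using L R LR by (intro connectedin_Un) (auto simp: irreducible_between_def)
  show "x \<in> L \<union> R" "z \<in> L \<union> R" using L R by (auto simp: irreducible_between_def)
  fix G assume G: "connectedin X G \<and> x \<in> G \<and> z \<in> G \<and> G \<subseteq> L \<union> R"
  have sep: "separatedin X (L - R) (R - L)" by (rule separatedin_closedin_diff[OF L(2) R(2)])
  have xL: "x \<in> L" "z \<in> R" using L R by (auto simp: irreducible_between_def)
  have pG: "p \<in> G"
  proof (rule ccontr)
    assume p: "p \<notin> G"
    then have "G \<subseteq> (L - R) \<union> (R - L)" using G LR by auto
    then have "G \<subseteq> L - R \<or> G \<subseteq> R - L"
      using G sep by (intro connectedin_subset_separated_union) auto
    then show False using G xL by auto
  qed
  \<comment> \<open>Serves both halves: \<open>G \<inter> P\<close> is one side of the cut of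
    \<open>G\<close> at \<open>p\<close>, with \<open>p\<close> restored.\<close>
  have *: "P \<subseteq> G" if P: "irreducible_between X P p u" "P \<inter> Q = {p}" "G \<subseteq> P \<union> Q" "u \<in> G"
    "separatedin X (P - Q) (Q - P)" for P Q u
  proof -
    have "separatedin X (G \<inter> (P - Q)) (G \<inter> (Q - P))"
      using P(5) by (rule separatedin_mono) auto
    moreover have "G - {p} = G \<inter> (P - Q) \<union> G \<inter> (Q - P)" using P(2,3) by auto
    ultimately have "connectedin X (insert p (G \<inter> (P - Q)))"
      using connectedin_insert_separated[of X G p] G pG by auto
    moreover have "insert p (G \<inter> (P - Q)) = G \<inter> P" using P(2) pG by auto
    ultimately have "G \<inter> P = P"
      using P(1,4) pG unfolding irreducible_between_def by (metis IntI inf_le2)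
    then show ?thesis by auto
  qed
  have "L \<subseteq> G"
    by (rule *[of L x R]) (use L LR G sep in \<open>auto intro: irreducible_between_sym\<close>)
  moreover have "R \<subseteq> G"
    by (rule *[of R z L]) (use R LR G sep in \<open>auto simp: separatedin_sym\<close>)
  ultimately show "G = L \<union> R" using G by auto
qed

text \<open>The two sets may meet many times. Follow \<open>A\<close> from \<open>x\<close> to its
  first point \<open>p\<close> in \<open>B\<close>, then follow \<open>B\<close> to
  \<open>z\<close>; these pieces meet only in \<open>p\<close>.\<close>

lemma irreducible_between_join:
  assumes X: "Hausdorff_space X"
    and A: "irreducible_between X A x y" "compactin X A"
    and B: "irreducible_between X B y z" "compactin X B"
  obtains D where "irreducible_between X D x z" "compactin X D" "D \<subseteq> A \<union> B"
proof -
  let ?r = "irreducible_order X A x"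
  let ?L = "\<lambda>p. {a. (a, p) \<in> ?r}"
  have t1: "t1_space X" by (rule Hausdorff_imp_t1_space[OF X])
  have clA: "closedin X A" and clB: "closedin X B"
    using compactin_imp_closedin[OF X] A B by auto
  have yAB: "y \<in> A \<inter> B" using A B by (auto simp: irreducible_between_def)
  have closed: "closedin X (?L a)" if "a \<in> A" for a
    by (rule closedin_trans_full[OF irreducible_between_initial_segment(3)[OF t1 A(1) that] clA])
  \<comment> \<open>The initial segments of \<open>A\<close> ending in points of \<open>B\<close>,
    cut down to \<open>B\<close>, form a chain of compact sets. A common point precedes every point
    of \<open>A \<inter> B\<close>, so it is the first one.\<close>
  let ?\<C> = "(\<lambda>a. ?L a \<inter> B) ` (A \<inter> B)"
  have rfl: "(a, a) \<in> ?r" if "a \<in> A" for a using that by (auto simp: irreducible_order_def)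
  have "\<Inter>?\<C> \<noteq> {}"
  proof (rule compactin_chain_Inter_nonempty)
    show "?L y \<inter> B \<in> ?\<C>" using yAB by auto
    show "compactin X (?L y \<inter> B)" using closed_Int_compactin[OF closed B(2)] yAB by auto
    show "closedin X S" if "S \<in> ?\<C>" for S using that closed clB by auto
    show "S \<noteq> {}" if "S \<in> ?\<C>" for S using that rfl by auto
    show "S \<subseteq> T \<or> T \<subseteq> S" if ST: "S \<in> ?\<C>" "T \<in> ?\<C>" for S T
    proof -
      obtain a b where ab: "a \<in> A" "b \<in> A" "S = ?L a \<inter> B" "T = ?L b \<inter> B" using ST by auto
      have "(a, b) \<in> ?r \<or> (b, a) \<in> ?r"
        using irreducible_order_facts(2)[OF A(1) ab(1)] ab(2) rfl[OF ab(2)]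
        by (auto simp: underS_def aboveS_def)
      then show ?thesis
        using irreducible_between_initial_segment(4)[OF t1 A(1) ab(1)]
          irreducible_between_initial_segment(4)[OF t1 A(1) ab(2)] unfolding ab(3,4) by auto
    qed
  qed
  then obtain p where "p \<in> \<Inter>?\<C>" unfolding ex_in_conv[symmetric] by (elim exE)
  then have p: "(p, a) \<in> ?r \<and> p \<in> B" if "a \<in> A \<inter> B" for a
    using InterD[of p ?\<C> "?L a \<inter> B"] that by simp
  have pA: "p \<in> A" "p \<in> B" using p[OF yAB] by (auto simp: irreducible_order_def)
  have LB: "?L p \<inter> B = {p}"
  proof -
    have "q = p" if "(q, p) \<in> ?r" "q \<in> B" for q
    proof -
      have "q \<in> A" using that by (auto simp: irreducible_order_def)
      then show ?thesis using p[of q] that irreducible_order_facts(6)[OF A(1) pA(1)] by auto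
    qed
    then show ?thesis using rfl pA by auto
  qed
  have B': "irreducible_between X B z y" by (rule irreducible_between_sym[OF B(1)])
  \<comment> \<open>The part of \<open>B\<close> from \<open>p\<close> to \<open>z\<close> is an
    initial segment for the order seen from \<open>z\<close>, so the facts about initial segments
    cover it too.\<close>
  let ?R = "{a. (a, p) \<in> irreducible_order X B z}"
  note LL = irreducible_between_initial_segment[OF t1 A(1) pA(1)]
  note RR = irreducible_between_initial_segment[OF t1 B' pA(2)]
  have clR: "closedin X ?R" by (rule closedin_trans_full[OF RR(3) clB])
  have R: "irreducible_between X ?R p z" by (rule irreducible_between_sym[OF RR(1)])
  have "p \<in> ?R" using R by (simp add: irreducible_between_def)
  then have "?L p \<inter> ?R = {p}" using LB RR(2) by auto
  then have "irreducible_between X (?L p \<union> ?R) x z"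
    by (rule irreducible_between_append[OF LL(1) closed[OF pA(1)] R clR])
  moreover have "compactin X (?L p \<union> ?R)"
    by (intro compactin_Un closed_compactin[OF A(2) LL(2) closed[OF pA(1)]]
        closed_compactin[OF B(2) RR(2) clR])
  moreover have "?L p \<union> ?R \<subseteq> A \<union> B" using LL(2) RR(2) by auto
  ultimately show thesis by (rule that)
qed

section \<open>Segments in charts, convex hulls and closures, and arcs inside connected convex
  sets\<close>

section \<open>Convex sets\<close>

lemma cspace_convex_Int: "cspace_convex C A \<Longrightarrow> cspace_convex C B \<Longrightarrow> cspace_convex C (A \<inter> B)"
  by (simp add: cspace_convex_def)

text \<open>Restates the chart axioms with open and connected sets of \<open>Y\<close> in place of
  those of the subspace \<open>V\<close>; (C2) becomes irreducibility.\<close>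

lemma local_convexity_structure_chart:
  assumes atlas: "local_convexity_structure Y \<V>" and VC: "(V, C) \<in> \<V>"
  shows "openin Y V"
    and "convexity_space (subtopology Y V) C"
    and "\<And>u v. u \<in> V \<Longrightarrow> v \<in> V \<Longrightarrow> irreducible_between Y (C u v) u v"
    and "\<And>u v. u \<in> V \<Longrightarrow> v \<in> V \<Longrightarrow> C u v \<subseteq> V"
    and "\<And>u v. u \<in> V \<Longrightarrow> v \<in> V \<Longrightarrow> cspace_convex C (C u v)"
    and "\<And>p U. p \<in> V \<Longrightarrow> openin Y U \<Longrightarrow> p \<in> U \<Longrightarrow>
           \<exists>B. openin Y B \<and> cspace_convex C B \<and> p \<in> B \<and> B \<subseteq> U \<and> B \<subseteq> V"
proof -
  show V: "openin Y V" and cs: "convexity_space (subtopology Y V) C"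
    using atlas VC by (auto simp: local_convexity_structure_def)
  have top: "topspace (subtopology Y V) = V" using openin_subset[OF V] by auto
  fix u v assume uv: "u \<in> V" "v \<in> V"
  have 1: "connectedin Y (C u v) \<and> C u v \<subseteq> V \<and> u \<in> C u v \<and> v \<in> C u v"
    and 2: "\<forall>A. connectedin (subtopology Y V) A \<and> u \<in> A \<and> v \<in> A \<and> A \<subseteq> C u v \<longrightarrow> A = C u v"
    using cs uv unfolding convexity_space_def top connectedin_subtopology by simp_all
  show "C u v \<subseteq> V" using 1 by simp
  show "cspace_convex C (C u v)" using cs uv unfolding convexity_space_def top by simp
  show "irreducible_between Y (C u v) u v"
    unfolding irreducible_between_def
  proof (intro conjI allI impI)
    fix B assume B: "connectedin Y B \<and> u \<in> B \<and> v \<in> B \<and> B \<subseteq> C u v"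
    then have "B \<subseteq> V" using 1 by (meson order_trans)
    then show "B = C u v" using 2 B by (simp add: connectedin_subtopology)
  qed (use 1 in simp_all)
next
  fix p U assume p: "p \<in> V" "openin Y U" "p \<in> U"
  have V: "openin Y V" and cs: "convexity_space (subtopology Y V) C"
    using atlas VC by (auto simp: local_convexity_structure_def)
  have "openin (subtopology Y V) (U \<inter> V)"
    using p(2) by (auto simp: openin_subtopology)
  then obtain B where B: "openin (subtopology Y V) B" "cspace_convex C B" "p \<in> B" "B \<subseteq> U \<inter> V"
    using cs p(1,3) unfolding convexity_space_def by (meson IntI)
  then have "openin Y B" using openin_trans_full[OF B(1) V] by simp
  then show "\<exists>B. openin Y B \<and> cspace_convex C B \<and> p \<in> B \<and> B \<subseteq> U \<and> B \<subseteq> V"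
    using B by (intro exI[of _ B]) simp
qed

text \<open>A nonempty convex set is the union of the segments \<open>C a b\<close> issuing from one
  of its points \<open>a\<close>.\<close>

lemma connectedin_cspace_convex:
  assumes atlas: "local_convexity_structure Y \<V>" "(V, C) \<in> \<V>"
    and A: "cspace_convex C A" "A \<subseteq> V"
  shows "connectedin Y A"
proof (cases "A = {}")
  case False
  then obtain a where a: "a \<in> A" by auto
  have irr: "irreducible_between Y (C a b) a b" if "b \<in> A" for b
    using local_convexity_structure_chart(3)[OF atlas] a that A(2) by (meson subsetD)
  have "connectedin Y (\<Union>(C a ` A))"
  proof (rule connectedin_Union)
    show "connectedin Y S" if "S \<in> C a ` A" for S
      using that irr by (auto simp: irreducible_between_def)
    have "a \<in> \<Inter>(C a ` A)" using irr by (auto simp: irreducible_between_def)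
    then show "\<Inter>(C a ` A) \<noteq> {}" by blast
  qed
  moreover have "\<Union>(C a ` A) = A"
  proof
    show "\<Union>(C a ` A) \<subseteq> A" using A(1) a by (auto simp: cspace_convex_def)
    show "A \<subseteq> \<Union>(C a ` A)" using irr by (auto simp: irreducible_between_def)
  qed
  ultimately show ?thesis by simp
qed simp

text \<open>A convex neighbourhood from (C3) meets the convex set \<open>C u v\<close> in a convex,
  hence connected, set. This is the local connectedness that
  \<open>irreducible_between_compactin\<close> asks for.\<close>

lemma compactin_convexity_segment:
  assumes atlas: "local_convexity_structure Y \<V>" "(V, C) \<in> \<V>" and uv: "u \<in> V" "v \<in> V"
  shows "compactin Y (C u v)"
proof (rule irreducible_between_compactin)
  note ch = local_convexity_structure_chart[OF atlas]
  show "irreducible_between Y (C u v) u v" by (rule ch(3)[OF uv])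
  fix a U assume a: "a \<in> C u v" "openin Y U" "a \<in> U"
  have "a \<in> V" using a(1) ch(4)[OF uv] by (rule subsetD[rotated])
  then obtain B where B: "openin Y B" "cspace_convex C B" "a \<in> B" "B \<subseteq> U" "B \<subseteq> V"
    using ch(6)[OF \<open>a \<in> V\<close> a(2,3)] by (elim exE conjE)
  have "connectedin Y (B \<inter> C u v)"
    by (rule connectedin_cspace_convex[OF atlas])
      (use B cspace_convex_Int[OF B(2) ch(5)[OF uv]] in auto)
  then show "\<exists>W. openin (subtopology Y (C u v)) W \<and> a \<in> W \<and> W \<subseteq> U \<and> connectedin Y W"
    using B a by (intro exI[of _ "B \<inter> C u v"]) (auto simp: openin_subtopology)
qed

lemma lc_convex_chart:
  "lc_convex Y \<V> A \<Longrightarrow> (V, C) \<in> \<V> \<Longrightarrow> cspace_convex C (A \<inter> V)"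
  unfolding lc_convex_def by (drule conjunct2, drule (1) bspec) simp

lemma lc_convexD:
  assumes "lc_convex Y \<V> A" "(V, C) \<in> \<V>" "u \<in> A" "v \<in> A" "u \<in> V" "v \<in> V"
  shows "C u v \<subseteq> A"
  using lc_convex_chart[OF assms(1,2)] assms(3-6) by (simp add: cspace_convex_def)

lemma lc_convexI:
  assumes "local_convexity_structure Y \<V>" "A \<subseteq> topspace Y"
    and "\<And>V C u v. (V, C) \<in> \<V> \<Longrightarrow> u \<in> A \<Longrightarrow> v \<in> A \<Longrightarrow> u \<in> V \<Longrightarrow> v \<in> V \<Longrightarrow> C u v \<subseteq> A"
  shows "lc_convex Y \<V> A"
  unfolding lc_convex_def cspace_convex_def
proof (intro conjI ballI assms(2), clarify)
  fix V C u v w assume "(V, C) \<in> \<V>" "u \<in> A" "u \<in> V" "v \<in> A" "v \<in> V" "w \<in> C u v"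
  then show "w \<in> A \<inter> V"
    using assms(3)[of V C u v] local_convexity_structure_chart(4)[OF assms(1), of V C u v] by auto
qed

lemma lc_convex_Inter:
  assumes atlas: "local_convexity_structure Y \<V>" and "\<F> \<noteq> {}" "\<And>A. A \<in> \<F> \<Longrightarrow> lc_convex Y \<V> A"
  shows "lc_convex Y \<V> (\<Inter>\<F>)"
proof (rule lc_convexI[OF atlas])
  show "\<Inter>\<F> \<subseteq> topspace Y" using assms(2,3) by (auto simp: lc_convex_def)
  show "C u v \<subseteq> \<Inter>\<F>" if "(V, C) \<in> \<V>" "u \<in> \<Inter>\<F>" "v \<in> \<Inter>\<F>" "u \<in> V" "v \<in> V" for V C u v
    using lc_convexD[OF assms(3) that(1)] that by (meson Inter_greatest InterD)
qed

lemma lc_hull_superset: "A \<subseteq> lc_hull Y \<V> A"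
  unfolding lc_hull_def by (rule hull_subset)

lemma lc_hull_minimal: "A \<subseteq> B \<Longrightarrow> lc_convex Y \<V> B \<Longrightarrow> lc_hull Y \<V> A \<subseteq> B"
  unfolding lc_hull_def by (rule hull_minimal)

lemma lc_hull_mono: "A \<subseteq> B \<Longrightarrow> lc_hull Y \<V> A \<subseteq> lc_hull Y \<V> B"
  unfolding lc_hull_def by (rule hull_mono)

lemma lc_convex_lc_hull:
  assumes atlas: "local_convexity_structure Y \<V>" and A: "A \<subseteq> topspace Y"
  shows "lc_convex Y \<V> (lc_hull Y \<V> A)"
proof -
  \<comment> \<open>The hull is the intersection of all convex supersets, which would be
    \<open>UNIV\<close> if there were none; the whole space is one.\<close>
  have "lc_convex Y \<V> (topspace Y)"
  proof (rule lc_convexI[OF atlas order_refl])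
    show "C u v \<subseteq> topspace Y" if "(V, C) \<in> \<V>" "u \<in> V" "v \<in> V" for V C u v
      by (rule order_trans[OF local_convexity_structure_chart(4)[OF atlas that]
            openin_subset[OF local_convexity_structure_chart(1)[OF atlas that(1)]]])
  qed
  then show ?thesis
    unfolding lc_hull_def hull_def using A by (intro lc_convex_Inter[OF atlas]) auto
qed

text \<open>Let \<open>D\<close> be the largest connected set between \<open>A\<close> and its hull.
  Adding a segment between two points of \<open>D\<close> keeps it connected and inside the hull, so
  \<open>D\<close> is convex by maximality and thus equal to the hull.\<close>

lemma connectedin_lc_hull:
  assumes atlas: "local_convexity_structure Y \<V>" and A: "connectedin Y A" "A \<noteq> {}"
  shows "connectedin Y (lc_hull Y \<V> A)"
proof -
  let ?H = "lc_hull Y \<V> A"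
  define D where "D = \<Union>{T. connectedin Y T \<and> A \<subseteq> T \<and> T \<subseteq> ?H}"
  have H: "lc_convex Y \<V> ?H"
    by (rule lc_convex_lc_hull[OF atlas connectedin_subset_topspace[OF A(1)]])
  have AH: "A \<subseteq> ?H" by (rule lc_hull_superset)
  have AD: "A \<subseteq> D" using A AH by (auto simp: D_def)
  have DH: "D \<subseteq> ?H" by (auto simp: D_def)
  have con: "connectedin Y D"
    unfolding D_def by (rule connectedin_Union) (use A(2) in auto)
  have "lc_convex Y \<V> D"
  proof (rule lc_convexI[OF atlas connectedin_subset_topspace[OF con]])
    fix V C u v assume V: "(V, C) \<in> \<V>" and uv: "u \<in> D" "v \<in> D" "u \<in> V" "v \<in> V"
    have irr: "irreducible_between Y (C u v) u v"
      by (rule local_convexity_structure_chart(3)[OF atlas V uv(3,4)])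
    have "connectedin Y (D \<union> C u v)"
      by (rule connectedin_Un[OF con]) (use irr uv in \<open>auto simp: irreducible_between_def\<close>)
    moreover have "C u v \<subseteq> ?H" using lc_convexD[OF H V _ _ uv(3,4)] uv DH by auto
    ultimately have "D \<union> C u v \<subseteq> D" using AD DH by (subst (2) D_def) auto
    then show "C u v \<subseteq> D" by simp
  qed
  then have "?H \<subseteq> D" by (rule lc_hull_minimal[OF AD])
  then show ?thesis using con DH by simp
qed

lemma lc_convex_closure_of:
  assumes Y: "Hausdorff_space Y" and atlas: "local_convexity_structure Y \<V>"
    and K: "lc_convex Y \<V> K"
  shows "lc_convex Y \<V> (Y closure_of K)"
proof (rule lc_convexI[OF atlas closure_of_subset_topspace])
  fix V C u v assume V: "(V, C) \<in> \<V>" and uv: "u \<in> Y closure_of K" "v \<in> Y closure_of K" "u \<in> V" "v \<in> V"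
  let ?A = "C u v"
  note ch = local_convexity_structure_chart[OF atlas V]
  have irr: "irreducible_between Y ?A u v" by (rule ch(3)[OF uv(3,4)])
  have AY: "?A \<subseteq> topspace Y" using irr connectedin_subset_topspace by (auto simp: irreducible_between_def)
  have cpt: "compactin Y ?A" by (rule compactin_convexity_segment[OF atlas V uv(3,4)])
  show "?A \<subseteq> Y closure_of K"
  proof (rule ccontr)
    assume "\<not> ?A \<subseteq> Y closure_of K"
    then obtain z where z: "z \<in> ?A" "z \<notin> Y closure_of K" by auto
    obtain N where N: "openin Y N" "z \<in> N" "N \<inter> K = {}"
      using z AY unfolding in_closure_of by auto
    \<comment> \<open>An open set missing \<open>K\<close> misses its closure. So \<open>u\<close>
      and \<open>v\<close> lie outside \<open>N\<close>, in particular differ from \<open>z\<close>,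
      and fall on opposite sides of the cut at \<open>z\<close>.\<close>
    have nN: "w \<notin> N" if "w \<in> Y closure_of K" for w
      using that N(1,3) unfolding in_closure_of by auto
    obtain E F where EF: "separatedin Y E F" "?A - {z} = E \<union> F" "u \<in> insert z E" "v \<in> insert z F"
      by (rule irreducible_between_cut[OF irr z(1)])
    \<comment> \<open>Within \<open>?A\<close>, closing a side of the cut can add only
      \<open>z\<close>. Removing the neighbourhood \<open>N\<close> of \<open>z\<close> therefore
      leaves a closed part of the compact segment.\<close>
    have cptd: "compactin Y (P - N)" if "separatedin Y P Q" "?A - {z} = P \<union> Q" for P Q
    proof -
      have "P - N = ?A \<inter> (Y closure_of P - N)"
      proof
        have "P \<subseteq> Y closure_of P" using that(1) by (intro closure_of_subset) (auto simp: separatedin_def)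
        then show "P - N \<subseteq> ?A \<inter> (Y closure_of P - N)" using that(2) by auto
        have "Y closure_of P \<inter> Q = {}" using that(1) by (auto simp: separatedin_def)
        then show "?A \<inter> (Y closure_of P - N) \<subseteq> P - N" using that(2) N(2) by auto
      qed
      then show ?thesis
        using compact_Int_closedin[OF cpt closedin_diff[OF closedin_closure_of N(1)]] by simp
    qed
    have "disjnt (E - N) (F - N)" using separatedin_Int_empty[OF EF(1)] by (auto simp: disjnt_def)
    then obtain O1 O2 where O: "openin Y O1" "openin Y O2" "E - N \<subseteq> O1" "F - N \<subseteq> O2" "disjnt O1 O2"
      using Hausdorff_space_compact_separation[OF Y cptd[OF EF(1,2)]
        cptd[of F E, OF separatedin_sym[THEN iffD1, OF EF(1)]]] EF(2) by (metis Un_commute)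
    \<comment> \<open>This open set contains the segment, so by continuity of \<open>C\<close> it
      contains all segments with end points near \<open>u\<close> and \<open>v\<close>.\<close>
    let ?W = "O1 \<union> O2 \<union> N"
    have AW: "?A \<subseteq> ?W"
    proof
      fix a assume "a \<in> ?A"
      then have "a = z \<or> a \<in> E \<or> a \<in> F" using EF(2) by auto
      then show "a \<in> ?W" using N(2) O(3,4) by auto
    qed
    have uO: "u \<in> O1" "v \<in> O2"
      using EF(3,4) nN[OF uv(1)] nN[OF uv(2)] N(2) O(3,4) by auto
    let ?X = "subtopology Y V"
    have top: "topspace ?X = V" using openin_subset[OF ch(1)] by auto
    have cont: "continuous_map (prod_topology ?X ?X) (powerset_topology ?X) (\<lambda>(x, y). C x y)"
      using ch(2) by (simp add: convexity_space_def)
    have "openin ?X (?W \<inter> V)"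
      using N(1) O(1,2) by (intro openin_subtopology_Int openin_Un)
    then have "openin (powerset_topology ?X) (Pow (?W \<inter> V))"
      unfolding powerset_topology_def
      by (intro topology_generated_by_Basis CollectI exI[of _ "?W \<inter> V"] conjI refl)
    then have "openin (prod_topology ?X ?X)
        {p \<in> topspace (prod_topology ?X ?X). (\<lambda>(x, y). C x y) p \<in> Pow (?W \<inter> V)}"
      by (rule openin_continuous_map_preimage[OF cont])
    moreover have "(u, v) \<in> {p \<in> topspace (prod_topology ?X ?X). (\<lambda>(x, y). C x y) p \<in> Pow (?W \<inter> V)}"
      using uv(3,4) AW ch(4)[OF uv(3,4)] by (simp add: top del: topspace_subtopology)
    ultimately obtain U1 U2 where U: "openin ?X U1" "openin ?X U2" "u \<in> U1" "v \<in> U2"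
      "U1 \<times> U2 \<subseteq> {p \<in> topspace (prod_topology ?X ?X). (\<lambda>(x, y). C x y) p \<in> Pow (?W \<inter> V)}"
      unfolding openin_prod_topology_alt by (elim allE impE exE conjE)
    have UY: "openin Y U1" "openin Y U2"
      using openin_trans_full[OF U(1) ch(1)] openin_trans_full[OF U(2) ch(1)] by auto
    obtain u' where u': "u' \<in> K" "u' \<in> U1 \<inter> O1"
      using uv(1) openin_Int[OF UY(1) O(1)] U(3) uO(1) unfolding in_closure_of by (metis IntI)
    obtain v' where v': "v' \<in> K" "v' \<in> U2 \<inter> O2"
      using uv(2) openin_Int[OF UY(2) O(2)] U(4) uO(2) unfolding in_closure_of by (metis IntI)
    have "(u', v') \<in> U1 \<times> U2" using u' v' by simp
    from subsetD[OF U(5) this] have V': "u' \<in> V" "v' \<in> V" "C u' v' \<subseteq> ?W"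
      by (simp_all add: top del: topspace_subtopology)
    \<comment> \<open>End points chosen in \<open>K\<close> keep the whole segment in
      \<open>K\<close> and so away from \<open>N\<close>; it would then have to be connected across
      the disjoint open sets \<open>O1\<close> and \<open>O2\<close>.\<close>
    have "C u' v' \<subseteq> K" by (rule lc_convexD[OF K V u'(1) v'(1) V'(1,2)])
    then have sub: "C u' v' \<subseteq> O1 \<union> O2" using V'(3) N(3) by auto
    have irr': "irreducible_between Y (C u' v') u' v'" by (rule ch(3)[OF V'(1,2)])
    have sep: "separatedin Y O1 O2" using O by (simp add: separatedin_open_sets)
    have "C u' v' \<subseteq> O1 \<or> C u' v' \<subseteq> O2"
      by (rule connectedin_subset_separated_union[OF _ sep sub])
        (use irr' in \<open>simp add: irreducible_between_def\<close>)
    moreover have "u' \<in> C u' v'" "v' \<in> C u' v'" using irr' by (simp_all add: irreducible_between_def)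
    ultimately show False using u'(2) v'(2) O(5) by (auto simp: disjnt_def)
  qed
qed

lemma irreducible_between_singleton: "x \<in> topspace Y \<Longrightarrow> irreducible_between Y {x} x x"
  by (auto simp: irreducible_between_def)

text \<open>Segments in charts are spliced by local propagation. The finite set \<open>F\<close> of
  points used is recorded so that (G1) can enclose the closed hull of the arc in a compact
  set.\<close>

lemma connected_lc_convex_imp_arc:
  assumes Y: "Hausdorff_space Y" and atlas: "local_convexity_structure Y \<V>"
    and K: "lc_convex Y \<V> K" "connectedin Y K" and x: "x \<in> K" and y: "y \<in> K"
  obtains F A where "finite F" "F \<subseteq> K" "irreducible_between Y A x y" "compactin Y A"
    "A \<subseteq> lc_hull Y \<V> F"
proof -
  have KY: "K \<subseteq> topspace Y" by (rule connectedin_subset_topspace[OF K(2)])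
  let ?P = "\<lambda>t. \<exists>F A. finite F \<and> F \<subseteq> K \<and> irreducible_between Y A x t \<and> compactin Y A \<and> A \<subseteq> lc_hull Y \<V> F"
  have "?P y"
  proof (rule connectedin_local_propagation[OF K(2) x _ y])
    show "?P x"
      using irreducible_between_singleton[of x Y] x KY lc_hull_superset[of "{x}" Y \<V>]
      by (intro exI[of _ "{x}"] conjI) auto
    fix p assume p: "p \<in> K"
    have "p \<in> (\<Union>(V, C)\<in>\<V>. V)"
      using atlas p KY by (auto simp: local_convexity_structure_def)
    then obtain V C where V: "(V, C) \<in> \<V>" "p \<in> V" by auto
    note ch = local_convexity_structure_chart[OF atlas V(1)]
    have step: "?P t" if s: "s \<in> K \<inter> V" and t: "t \<in> K \<inter> V" and Ps: "?P s" for s t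
    proof -
      obtain F A where F: "finite F" "F \<subseteq> K" "irreducible_between Y A x s" "compactin Y A"
        "A \<subseteq> lc_hull Y \<V> F" using Ps by (elim exE conjE)
      \<comment> \<open>The points \<open>s\<close> and \<open>t\<close> are added so that the new
        segment \<open>C s t\<close> lies in the hull.\<close>
      let ?F = "insert s (insert t F)"
      have st: "irreducible_between Y (C s t) s t" "compactin Y (C s t)"
        using ch(3) compactin_convexity_segment[OF atlas V(1)] s t by auto
      have "lc_convex Y \<V> (lc_hull Y \<V> ?F)"
        by (rule lc_convex_lc_hull[OF atlas]) (use F(2) s t KY in auto)
      then have "C s t \<subseteq> lc_hull Y \<V> ?F"
        by (rule lc_convexD[OF _ V(1)]) (use s t lc_hull_superset[of ?F Y \<V>] in auto)
      moreover have "A \<subseteq> lc_hull Y \<V> ?F"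
        using F(5) lc_hull_mono[of F ?F Y \<V>] by auto
      moreover obtain D where "irreducible_between Y D x t" "compactin Y D" "D \<subseteq> A \<union> C s t"
        by (rule irreducible_between_join[OF Y F(3,4) st])
      ultimately show ?thesis
        using F(1,2) s t by (intro exI[of _ ?F] exI[of _ D] conjI) auto
    qed
    show "\<exists>W. openin (subtopology Y K) W \<and> p \<in> W \<and> (\<forall>s\<in>W. \<forall>t\<in>W. ?P s \<longrightarrow> ?P t)"
    proof (rule exI[of _ "K \<inter> V"], intro conjI ballI impI)
      show "openin (subtopology Y K) (K \<inter> V)" by (rule openin_subtopology_Int2[OF ch(1)])
      show "p \<in> K \<inter> V" using p V(2) by simp
    qed (rule step)
  qed
  then show thesis using that by (elim exE conjE)
qed

section \<open>Minimality among closed connected convex sets, and its relation to geodesics\<close>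

section \<open>Minimal convex continua\<close>

text \<open>Members are closed but not assumed compact: the closed hull of an arc belongs here,
  while (G1) gives compactness only for hulls of finite sets.\<close>

definition convex_continua :: "'a topology \<Rightarrow> 'a atlas \<Rightarrow> 'a \<Rightarrow> 'a \<Rightarrow> 'a set set" where
  "convex_continua Y \<V> x y =
     {K. closedin Y K \<and> connectedin Y K \<and> lc_convex Y \<V> K \<and> x \<in> K \<and> y \<in> K}"

lemma simple_arcs_connectedin: "A \<in> simple_arcs Y x y \<Longrightarrow> connectedin Y A \<and> x \<in> A \<and> y \<in> A"
  by (auto simp: simple_arcs_def linear_continuum_on_def connectedin_def)

lemma closure_lc_hull_in_convex_continua:
  assumes Y: "Hausdorff_space Y" and atlas: "local_convexity_structure Y \<V>"
    and A: "connectedin Y A" "x \<in> A" "y \<in> A"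
  shows "Y closure_of lc_hull Y \<V> A \<in> convex_continua Y \<V> x y"
proof -
  have H: "lc_convex Y \<V> (lc_hull Y \<V> A)"
    by (rule lc_convex_lc_hull[OF atlas connectedin_subset_topspace[OF A(1)]])
  then have "lc_hull Y \<V> A \<subseteq> topspace Y" by (simp add: lc_convex_def)
  then have "A \<subseteq> Y closure_of lc_hull Y \<V> A"
    by (rule order_trans[OF lc_hull_superset closure_of_subset])
  moreover have "connectedin Y (Y closure_of lc_hull Y \<V> A)"
    using connectedin_closure_of connectedin_lc_hull[OF atlas A(1)] A(2) by blast
  ultimately show ?thesis
    using A lc_convex_closure_of[OF Y atlas H] by (auto simp: convex_continua_def)
qed

lemma closure_lc_hull_minimal:
  assumes "A \<subseteq> K" "closedin Y K" "lc_convex Y \<V> K"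
  shows "Y closure_of lc_hull Y \<V> A \<subseteq> K"
  by (rule closure_of_minimal[OF lc_hull_minimal[OF assms(1,3)] assms(2)])

text \<open>The arc supplied lies in the hull of a finite subset of \<open>K\<close>, whose closure
  is compact by (G1). This is the way down from a possibly noncompact \<open>K\<close> to a compact
  continuum.\<close>

lemma convex_continuum_contains_simple_arc:
  assumes Y: "geodesic_manifold Y \<V>" and K: "K \<in> convex_continua Y \<V> x y"
  obtains B where "B \<in> simple_arcs Y x y" "Y closure_of lc_hull Y \<V> B \<subseteq> K"
    "compactin Y (Y closure_of lc_hull Y \<V> B)"
proof -
  have Hd: "Hausdorff_space Y" and atlas: "local_convexity_structure Y \<V>"
    and fin: "\<And>F. finite F \<Longrightarrow> F \<subseteq> topspace Y \<Longrightarrow> compactin Y (Y closure_of lc_hull Y \<V> F)"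
    using Y unfolding geodesic_manifold_def by blast+
  have K': "closedin Y K" "connectedin Y K" "lc_convex Y \<V> K" "x \<in> K" "y \<in> K"
    using K by (auto simp: convex_continua_def)
  have KY: "K \<subseteq> topspace Y" by (rule closedin_subset[OF K'(1)])
  obtain F B where F: "finite F" "F \<subseteq> K" and B: "irreducible_between Y B x y" "compactin Y B"
    "B \<subseteq> lc_hull Y \<V> F"
    by (rule connected_lc_convex_imp_arc[OF Hd atlas K'(3,2,4,5)])
  have FY: "F \<subseteq> topspace Y" using F(2) KY by simp
  have "lc_hull Y \<V> B \<subseteq> lc_hull Y \<V> F"
    by (rule lc_hull_minimal[OF B(3) lc_convex_lc_hull[OF atlas FY]])
  then have sub: "Y closure_of lc_hull Y \<V> B \<subseteq> Y closure_of lc_hull Y \<V> F"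
    by (rule closure_of_mono)
  show thesis
  proof (rule that)
    show "B \<in> simple_arcs Y x y" by (rule irreducible_between_simple_arc[OF Hd B(1,2)])
    show "Y closure_of lc_hull Y \<V> B \<subseteq> K"
      using sub closure_lc_hull_minimal[OF F(2) K'(1,3)] by (rule order_trans)
    show "compactin Y (Y closure_of lc_hull Y \<V> B)"
      by (rule closed_compactin[OF fin[OF F(1) FY] sub closedin_closure_of])
  qed
qed

text \<open>Trades arcs for their closed hulls: the closed hull of an arc is a convex continuum, and
  every convex continuum contains the closed hull of an arc, so minimality may be tested on either.
  The gain is that convex continua inside a compact set are stable under intersections of nonempty
  chains, as Zorn's lemma needs.\<close>

lemma minimal_arc_iff:
  assumes Y: "geodesic_manifold Y \<V>" and A: "A \<in> simple_arcs Y x y"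
  shows "minimal_arc Y \<V> x y A \<longleftrightarrow>
    (\<forall>K\<in>convex_continua Y \<V> x y. K \<subseteq> Y closure_of lc_hull Y \<V> A \<longrightarrow> K = Y closure_of lc_hull Y \<V> A)"
    (is "_ \<longleftrightarrow> (\<forall>K\<in>_. K \<subseteq> ?M \<longrightarrow> K = ?M)")
proof
  assume min: "minimal_arc Y \<V> x y A"
  show "\<forall>K\<in>convex_continua Y \<V> x y. K \<subseteq> ?M \<longrightarrow> K = ?M"
  proof (intro ballI impI)
    fix K assume K: "K \<in> convex_continua Y \<V> x y" "K \<subseteq> ?M"
    obtain B where B: "B \<in> simple_arcs Y x y" "Y closure_of lc_hull Y \<V> B \<subseteq> K"
      using convex_continuum_contains_simple_arc[OF Y K(1)] by metis
    then have "straightening Y \<V> B A" using K(2) by (simp add: straightening_def)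
    then have "straightening Y \<V> A B" using min B(1) by (simp add: minimal_arc_def)
    then show "K = ?M" using B(2) K(2) by (simp add: straightening_def)
  qed
next
  assume min: "\<forall>K\<in>convex_continua Y \<V> x y. K \<subseteq> ?M \<longrightarrow> K = ?M"
  have Hd: "Hausdorff_space Y" and atlas: "local_convexity_structure Y \<V>"
    using Y by (auto simp: geodesic_manifold_def)
  show "minimal_arc Y \<V> x y A"
    unfolding minimal_arc_def straightening_def
  proof (intro conjI A ballI impI)
    fix B assume B: "B \<in> simple_arcs Y x y" "Y closure_of lc_hull Y \<V> B \<subseteq> ?M"
    have "Y closure_of lc_hull Y \<V> B \<in> convex_continua Y \<V> x y"
      using closure_lc_hull_in_convex_continua[OF Hd atlas] simple_arcs_connectedin[OF B(1)] by simp
    then have "Y closure_of lc_hull Y \<V> B = ?M" using B(2) by (rule min[rule_format])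
    then show "?M \<subseteq> Y closure_of lc_hull Y \<V> B" by simp
  qed
qed

text \<open>Zorn's lemma for reverse inclusion. Below the compact \<open>K0\<close>, a nonempty
  chain is bounded by its intersection, which is connected by compactness; the empty chain is
  bounded by \<open>K0\<close>.\<close>

lemma minimal_convex_continuum_exists:
  assumes Hd: "Hausdorff_space Y" and atlas: "local_convexity_structure Y \<V>"
    and K0: "K0 \<in> convex_continua Y \<V> x y" "compactin Y K0"
  obtains M where "M \<in> convex_continua Y \<V> x y" "M \<subseteq> K0"
    "\<And>K. K \<in> convex_continua Y \<V> x y \<Longrightarrow> K \<subseteq> M \<Longrightarrow> K = M"
proof -
  let ?\<K> = "{K \<in> convex_continua Y \<V> x y. K \<subseteq> K0}"
  have "\<exists>M\<in>?\<K>. \<forall>K\<in>?\<K>. M \<supseteq> K \<longrightarrow> K = M"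
  proof (rule predicate_Zorn)
    show "partial_order_on ?\<K> (relation_of (\<supseteq>) ?\<K>)"
      by (auto simp: relation_of_def order_on_defs refl_on_def trans_def antisym_def)
    fix \<C> assume C: "\<C> \<in> Chains (relation_of (\<supseteq>) ?\<K>)"
    have mem: "S \<in> ?\<K>" and chain: "S \<subseteq> T \<or> T \<subseteq> S" if "S \<in> \<C>" "T \<in> \<C>" for S T
      using C that unfolding Chains_def relation_of_def by blast+
    show "\<exists>U\<in>?\<K>. \<forall>S\<in>\<C>. S \<supseteq> U"
    proof (cases "\<C> = {}")
      case True
      then show ?thesis using K0(1) by auto
    next
      case False
      then obtain S0 where S0: "S0 \<in> \<C>" by auto
      have cc: "closedin Y S" "connectedin Y S" "lc_convex Y \<V> S" "x \<in> S" "y \<in> S" "S \<subseteq> K0"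
        if "S \<in> \<C>" for S using mem[OF that that] by (auto simp: convex_continua_def)
      have "compactin Y S0" by (rule closed_compactin[OF K0(2) cc(6,1)[OF S0]])
      then have "connectedin Y (\<Inter>\<C>)"
        by (rule connectedin_chain_Inter[OF Hd _ S0 cc(1,2) chain])
      moreover have "closedin Y (\<Inter>\<C>)" using False cc(1) by (rule closedin_Inter)
      moreover have "lc_convex Y \<V> (\<Inter>\<C>)" by (rule lc_convex_Inter[OF atlas False cc(3)])
      moreover have "x \<in> \<Inter>\<C>" "y \<in> \<Inter>\<C>" using cc(4,5) by blast+
      moreover have "\<Inter>\<C> \<subseteq> K0" using S0 cc(6) by blast
      ultimately have "\<Inter>\<C> \<in> ?\<K>" unfolding convex_continua_def by simp
      then show ?thesis by (intro bexI[of _ "\<Inter>\<C>"]) auto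
    qed
  qed
  then obtain M where M: "M \<in> ?\<K>" "\<forall>K\<in>?\<K>. M \<supseteq> K \<longrightarrow> K = M" by (elim bexE)
  show thesis
  proof (rule that)
    show "M \<in> convex_continua Y \<V> x y" "M \<subseteq> K0" using M(1) by simp_all
    fix K assume K: "K \<in> convex_continua Y \<V> x y" "K \<subseteq> M"
    then have "K \<in> ?\<K>" using M(1) by auto
    then show "K = M" using M(2) K(2) by simp
  qed
qed

text \<open>For a chart \<open>(V, C)\<close>, the set \<open>M \<inter> V\<close> is a chart of the inclusion of \<open>M\<close>. Hence a closed subset
  that is convex in all charts of the inclusion is convex in \<open>Y\<close>, and minimality applies to it.\<close>

lemma minimal_convex_continuum_geodesic:
  assumes Hd: "Hausdorff_space Y" and atlas: "local_convexity_structure Y \<V>"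
    and M: "M \<in> convex_continua Y \<V> x y" and cpt: "compactin Y M"
    and min: "\<And>K. K \<in> convex_continua Y \<V> x y \<Longrightarrow> K \<subseteq> M \<Longrightarrow> K = M"
  shows "geodesic Y \<V> (subtopology Y M) (\<lambda>a. a) x y"
proof -
  let ?X = "subtopology Y M"
  have M': "closedin Y M" "connectedin Y M" "lc_convex Y \<V> M" "x \<in> M" "y \<in> M"
    using M by (auto simp: convex_continua_def)
  have MY: "M \<subseteq> topspace Y" by (rule closedin_subset[OF M'(1)])
  have top: "topspace ?X = M" using MY by auto
  have chart: "M \<inter> V \<in> etale_charts Y \<V> ?X (\<lambda>a. a)" if V: "(V, C) \<in> \<V>" for V C
  proof -
    have "openin ?X (M \<inter> V)"
      by (rule openin_subtopology_Int2[OF local_convexity_structure_chart(1)[OF atlas V]])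
    moreover have "homeomorphic_map (subtopology ?X (M \<inter> V)) (subtopology Y (M \<inter> V)) (\<lambda>a. a)"
      by (simp add: subtopology_subtopology inf.assoc[symmetric] flip: id_def)
    moreover have "cspace_convex C (M \<inter> V)" by (rule lc_convex_chart[OF M'(3) V])
    ultimately show ?thesis using V unfolding etale_charts_def by fastforce
  qed
  have "\<Union>(etale_charts Y \<V> ?X (\<lambda>a. a)) = topspace ?X"
  proof
    show "\<Union>(etale_charts Y \<V> ?X (\<lambda>a. a)) \<subseteq> topspace ?X"
      using openin_subset[of ?X] by (auto simp: etale_charts_def)
    show "topspace ?X \<subseteq> \<Union>(etale_charts Y \<V> ?X (\<lambda>a. a))"
    proof
      fix p assume p: "p \<in> topspace ?X"
      then have "p \<in> (\<Union>(V, C)\<in>\<V>. V)"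
        using atlas by (simp add: local_convexity_structure_def)
      then obtain V C where "(V, C) \<in> \<V>" "p \<in> V" by auto
      then show "p \<in> \<Union>(etale_charts Y \<V> ?X (\<lambda>a. a))"
        using chart p top by (intro UnionI[of "M \<inter> V"]) auto
    qed
  qed
  moreover have "closed_map ?X Y (\<lambda>a. a)"
    unfolding closed_map_def using closedin_trans_full[OF _ M'(1)] by simp
  moreover have "continuous_map ?X Y (\<lambda>a. a)"
    by (simp add: continuous_map_from_subtopology)
  moreover have "connected_space ?X" "compact_space ?X" "Hausdorff_space ?X"
    using M'(2) cpt Hd by (simp_all add: connectedin_def compactin_subspace Hausdorff_space_subtopology)
  moreover have "etale_generated Y \<V> ?X (\<lambda>a. a) {x, y}"
    unfolding etale_generated_def
  proof (intro conjI notI)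
    show "{x, y} \<subseteq> topspace ?X" using M'(4,5) top by simp
    assume "\<exists>A. closedin ?X A \<and> connectedin ?X A \<and> A \<subset> topspace ?X \<and> {x, y} \<subseteq> A \<and>
      (\<forall>U\<in>etale_charts Y \<V> ?X (\<lambda>a. a). lc_convex Y \<V> ((\<lambda>a. a) ` (U \<inter> A)))"
    then obtain A where A: "closedin ?X A" "connectedin ?X A" "A \<subset> topspace ?X" "{x, y} \<subseteq> A"
      and cA: "\<forall>U\<in>etale_charts Y \<V> ?X (\<lambda>a. a). lc_convex Y \<V> ((\<lambda>a. a) ` (U \<inter> A))"
      by (elim exE conjE)
    have AM: "A \<subseteq> M" "A \<noteq> M" using A(3) top by auto
    have "lc_convex Y \<V> A"
    proof (rule lc_convexI[OF atlas])
      show "A \<subseteq> topspace Y" using AM(1) MY by simp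
      fix V C u v assume V: "(V, C) \<in> \<V>" and uv: "u \<in> A" "v \<in> A" "u \<in> V" "v \<in> V"
      have "lc_convex Y \<V> (M \<inter> V \<inter> A)" using bspec[OF cA chart[OF V]] by simp
      then have "C u v \<subseteq> M \<inter> V \<inter> A"
        by (rule lc_convexD[OF _ V _ _ uv(3,4)]) (use uv AM(1) in auto)
      then show "C u v \<subseteq> A" by simp
    qed
    then have "A \<in> convex_continua Y \<V> x y"
      using closedin_trans_full[OF A(1) M'(1)] A(2,4)
      by (simp add: convex_continua_def connectedin_subtopology)
    then show False using min[OF _ AM(1)] AM(2) by simp
  qed
  ultimately show ?thesis by (simp add: geodesic_def etale_map_def)
qed

theorem theorem1:
  fixes Y :: "'a topology" and \<V> :: "'a atlas" and x y :: 'a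
  assumes "geodesic_manifold Y \<V>" and "x \<in> topspace Y" and "y \<in> topspace Y"
  shows "(\<forall>A\<in>simple_arcs Y x y. \<exists>C\<in>simple_arcs Y x y.
            minimal_arc Y \<V> x y C \<and> straightening Y \<V> C A) \<and>
         (\<forall>A\<in>simple_arcs Y x y.
            minimal_arc Y \<V> x y A \<longleftrightarrow> lc_convex Y \<V> A \<and> simple_geodesic Y \<V> x y A)"
proof (intro conjI ballI)
  have Hd: "Hausdorff_space Y" and atlas: "local_convexity_structure Y \<V>"
    using assms(1) by (auto simp: geodesic_manifold_def)
  fix A assume A: "A \<in> simple_arcs Y x y"
  let ?M = "Y closure_of lc_hull Y \<V> A"
  have conA: "connectedin Y A" "x \<in> A" "y \<in> A" using simple_arcs_connectedin[OF A] by auto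
  have M: "?M \<in> convex_continua Y \<V> x y"
    by (rule closure_lc_hull_in_convex_continua[OF Hd atlas conA])
  \<comment> \<open>It is not known beforehand that \<open>?M\<close> is compact. The compact closed
    hull of \<open>B\<close> inside \<open>?M\<close> serves both claims: Zorn's lemma starts from
    it, and it equals \<open>?M\<close> when \<open>A\<close> is minimal.\<close>
  obtain B where B: "B \<in> simple_arcs Y x y" "Y closure_of lc_hull Y \<V> B \<subseteq> ?M"
    "compactin Y (Y closure_of lc_hull Y \<V> B)"
    by (rule convex_continuum_contains_simple_arc[OF assms(1) M])
  have KB: "Y closure_of lc_hull Y \<V> B \<in> convex_continua Y \<V> x y"
    using closure_lc_hull_in_convex_continua[OF Hd atlas] simple_arcs_connectedin[OF B(1)] by simp
  show "\<exists>C\<in>simple_arcs Y x y. minimal_arc Y \<V> x y C \<and> straightening Y \<V> C A"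
  proof -
    obtain N where N: "N \<in> convex_continua Y \<V> x y" "N \<subseteq> Y closure_of lc_hull Y \<V> B"
      "\<And>K. K \<in> convex_continua Y \<V> x y \<Longrightarrow> K \<subseteq> N \<Longrightarrow> K = N"
      by (rule minimal_convex_continuum_exists[OF Hd atlas KB B(3)]) (rule that)
    \<comment> \<open>By minimality of \<open>N\<close>, the closed hull of any arc whose hull lies
      in \<open>N\<close> is all of \<open>N\<close>, so such an arc is minimal.\<close>
    obtain C where C: "C \<in> simple_arcs Y x y" "Y closure_of lc_hull Y \<V> C \<subseteq> N"
      using convex_continuum_contains_simple_arc[OF assms(1) N(1)] by metis
    have "Y closure_of lc_hull Y \<V> C \<in> convex_continua Y \<V> x y"
      using closure_lc_hull_in_convex_continua[OF Hd atlas] simple_arcs_connectedin[OF C(1)] by simp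
    then have CN: "Y closure_of lc_hull Y \<V> C = N" using N(3) C(2) by simp
    have "minimal_arc Y \<V> x y C"
      unfolding minimal_arc_iff[OF assms(1) C(1)] CN using N(3) by simp
    moreover have "straightening Y \<V> C A"
      unfolding straightening_def CN using N(2) B(2) by (rule order_trans)
    ultimately show ?thesis using C(1) by (intro bexI[of _ C] conjI)
  qed
  show "minimal_arc Y \<V> x y A \<longleftrightarrow> lc_convex Y \<V> A \<and> simple_geodesic Y \<V> x y A"
  proof
    assume "minimal_arc Y \<V> x y A"
    then have min: "K = ?M" if "K \<in> convex_continua Y \<V> x y" "K \<subseteq> ?M" for K
      using that by (simp add: minimal_arc_iff[OF assms(1) A])
    have cpt: "compactin Y ?M" using B(3) min[OF KB B(2)] by simp
    have geo: "geodesic Y \<V> (subtopology Y ?M) (\<lambda>a. a) x y"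
      by (rule minimal_convex_continuum_geodesic[OF Hd atlas M cpt min])
    have top: "topspace (subtopology Y ?M) = ?M" using closure_of_subset_topspace[of Y] by auto
    have "lc_hull Y \<V> A \<subseteq> topspace Y"
      using lc_convex_lc_hull[OF atlas connectedin_subset_topspace[OF conA(1)]]
      by (simp add: lc_convex_def)
    then have "A \<subseteq> ?M"
      by (rule order_trans[OF lc_hull_superset closure_of_subset])
    then have "connectedin (subtopology Y ?M) A"
      using conA(1) by (simp add: connectedin_subtopology)
    \<comment> \<open>(G2) in the geodesic \<open>?M\<close>: the connected set \<open>A\<close>
      contains both generating points, so it is all of \<open>?M\<close>.\<close>
    from geodesic_manifold_unique_connected[OF assms(1) geo this conA(2,3)]
    have AM: "A = ?M" unfolding top .
    have "lc_convex Y \<V> ?M" using M by (simp add: convex_continua_def)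
    then have "lc_convex Y \<V> A" using AM by simp
    moreover have "geodesic Y \<V> (subtopology Y A) (\<lambda>a. a) x y" using geo AM by simp
    ultimately show "lc_convex Y \<V> A \<and> simple_geodesic Y \<V> x y A"
      using conA connectedin_subset_topspace[OF conA(1)] by (simp add: simple_geodesic_def)
  next
    assume asm: "lc_convex Y \<V> A \<and> simple_geodesic Y \<V> x y A"
    then have geo: "geodesic Y \<V> (subtopology Y A) (\<lambda>a. a) x y" by (simp add: simple_geodesic_def)
    have AY: "A \<subseteq> topspace Y" by (rule connectedin_subset_topspace[OF conA(1)])
    \<comment> \<open>A geodesic is compact, so the convex set \<open>A\<close> is closed and
      contains its own closed hull.\<close>
    have "compactin Y A" using geo AY by (simp add: geodesic_def compactin_subspace)
    then have clA: "closedin Y A" by (rule compactin_imp_closedin[OF Hd])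
    have MA: "?M \<subseteq> A" by (rule closure_lc_hull_minimal[OF order_refl clA]) (use asm in simp)
    show "minimal_arc Y \<V> x y A"
      unfolding minimal_arc_iff[OF assms(1) A]
    proof (intro ballI impI)
      fix K assume K: "K \<in> convex_continua Y \<V> x y" "K \<subseteq> ?M"
      have "connectedin (subtopology Y A) K" "x \<in> K" "y \<in> K"
        using K MA by (auto simp: convex_continua_def connectedin_subtopology)
      \<comment> \<open>Here (G2) is applied in the geodesic \<open>A\<close>, to the connected set
        \<open>K\<close>.\<close>
      from geodesic_manifold_unique_connected[OF assms(1) geo this] have "K = A"
        using AY by auto
      then show "K = ?M" using K(2) MA by simp
    qed
  qed
qed

end
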